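(* Let $(N,A_1,A_2,\dots)$ be as in the context and satisfy Conditions (C1), (C2), (C4) with $\alpha\in(0,1)$, and (C6). Let $Z$ be an $\mathbb{R}_+^d$-valued solution of $Z\overset{\mathcal L}{=}\sum_{i=1}^NA_iZ_i$ with $\mathbb{P}[Z=0]=0$. Then for every cover set $U\subset\mathbb{U}$ of finite level and every family $\{(a_{u1},a_{u2},\dots)\}_{u\in\mathbb{U}}$ with each $(a_{u1},a_{u2},\dots)\in\mathrm{supp}(A_1,A_2,\dots)$, setting $g_V=\sum_{u\in V}a_{u|1}\cdots a_{u||u|}$ for $V\subset U$, the support $\mathrm{supp}(Z)$ contains $\sum_{V\subset U,\,g_V>0}\mathbb{R}_+v(g_V)$, i.e. every finite sum $\sum_j s_jv(g_{V_j})$ with $s_j\ge0$ and $V_j\subset U$, $g_{V_j}>0$.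
   Context: Notation: $G$ is the set of $d\times d$ nonnegative matrices; $|x|=\sum_i|x_i|$; $\|a\|$ operator norm, $r(a)$ spectral radius; $a>0$ means all entries strictly positive; $\mathbb{R}_+v=\{sv:s\ge0\}$; $\mathbb{S}_+^{d-1}=\{x\in\mathbb{R}_+^d:|x|=1\}$; $\iota(a)=\inf_{x\in\mathbb{S}_+^{d-1}}|ax|$; $\log_+y=\max(\log y,0)$, $\log_-y=\max(-\log y,0)$ with $\log0=-\infty$. Support of a random variable: set of points every neighborhood of which has positive probability (product topology on $G^{\mathbb{N}^*}$). Setting: random $A_i\in G$, $N=\#\{i:A_i\ne0\}<\infty$ a.s., $A_i\ne0$ iff $i\le N$; a solution is an $\mathbb{R}_+^d$-valued $Z$ with $Z\overset{\mathcal L}{=}\sum_{i=1}^NA_iZ_i$, $(Z_i)$ i.i.d. copies of $Z$ independent of $(N,A_1,\dots)$. $\mu$: the probability on $G$ with $\int f\,d\mu=\mathbb{E}[\sum_{i\le N}f(A_i)]/\mathbb{E}[N]$; $\Gamma$: multiplicative semigroup (with identity) generated by $\mathrm{supp}(\mu)$; for $a>0$, $v(a)$: positive eigenvector with $av(a)=r(a)v(a)$, $|v(a)|=1$. Ulam–Harris: $\mathbb{U}=\bigcup_{n\ge0}(\mathbb{N}^* )^n$, $u|k$ prefix of length $k$, $|u|$ length; cover set: every infinite sequence has exactly one prefix in it; level: $\sup_{u\in U}|u|$. (C1) $N\ge1$ a.s., $\mathbb{E}[N]\in(1,\infty)$, $A_i\in G$, $A_i\ne0$ iff $i\le N$. (C2)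 Every $a\in\Gamma$ has a strictly positive entry in each row and column; $\Gamma$ contains a strictly positive matrix. (C4) With $(M_i)$ i.i.d. of law $\mu$, $I_\mu=\{s\ge0:\int\|a\|^sd\mu<\infty\}$, $\kappa(s)=\lim_n\mathbb{E}[\|M_n\cdots M_1\|^s]^{1/n}$, $m(s)=\mathbb{E}[N]\kappa(s)$: there is $\alpha\in(0,1]\cap\mathrm{int}(I_\mu)$ with $m(\alpha)=1$, $m'(\alpha)<0$. (C6) $\int\|a\|^\alpha(\log_+\|a\|+\log_-\iota(a^T))\,d\mu(a)<\infty$. *)

theory Defs
  imports "HOL-Probability.Probability"
begin

type_synonym 'd rmat = "real ^ 'd ^ 'd"

definition nonneg_mat :: "'d::finite rmat \<Rightarrow> bool" where
  "nonneg_mat a \<longleftrightarrow> (\<forall>i j. 0 \<le> a $ i $ j)"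

definition pos_mat :: "'d::finite rmat \<Rightarrow> bool" where
  "pos_mat a \<longleftrightarrow> (\<forall>i j. 0 < a $ i $ j)"

definition l1 :: "real ^ 'd::finite \<Rightarrow> real" where
  "l1 x = (\<Sum>i\<in>UNIV. \<bar>x $ i\<bar>)"

definition opnorm :: "'d::finite rmat \<Rightarrow> real" where
  "opnorm a = (SUP x\<in>{x. l1 x = 1}. l1 (a *v x))"

definition iota :: "'d::finite rmat \<Rightarrow> real" where
  "iota a = (INF x\<in>{x. (\<forall>i. 0 \<le> x $ i) \<and> l1 x = 1}. l1 (a *v x))"

definition log_plus :: "real \<Rightarrow> ennreal" where
  "log_plus y = (if y \<le> 0 then 0 else ennreal (max (ln y) 0))"

definition log_minus :: "real \<Rightarrow> ennreal" where
  "log_minus y = (if y \<le> 0 then \<infinity> else ennreal (max (- ln y) 0))"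

definition spec_rad :: "'d::finite rmat \<Rightarrow> real" where
  "spec_rad a = Sup {cmod l | l. \<exists>v :: complex ^ 'd. v \<noteq> 0 \<and>
      (\<chi> i. \<Sum>j\<in>UNIV. complex_of_real (a $ i $ j) * v $ j) = (\<chi> i. l * v $ i)}"

definition perron_vec :: "'d::finite rmat \<Rightarrow> real ^ 'd" where
  "perron_vec a = (THE v. (\<forall>i. 0 < v $ i) \<and> l1 v = 1 \<and> a *v v = spec_rad a *\<^sub>R v)"

definition rv_supp :: "'w measure \<Rightarrow> ('w \<Rightarrow> 'b::topological_space) \<Rightarrow> 'b set" where
  "rv_supp M X = {x. \<forall>T. open T \<longrightarrow> x \<in> T \<longrightarrow> 0 < emeasure M {w \<in> space M. X w \<in> T}}"

definition meas_supp :: "'b::topological_space measure \<Rightarrow> 'b set" where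
  "meas_supp \<mu> = {x. \<forall>T. open T \<longrightarrow> x \<in> T \<longrightarrow> 0 < emeasure \<mu> T}"

text \<open>The measure mu on matrices: mu(B) = E[#{i<N. A_i in B}] / E[N]
  (matrices indexed from 0: A w i is A_{i+1} of the paper).\<close>
definition mu_meas :: "'w measure \<Rightarrow> ('w \<Rightarrow> nat) \<Rightarrow> ('w \<Rightarrow> nat \<Rightarrow> 'd::finite rmat)
    \<Rightarrow> 'd rmat measure" where
  "mu_meas M N A = measure_of UNIV (sets borel)
     (\<lambda>B. (\<integral>\<^sup>+ w. of_nat (card {i. i < N w \<and> A w i \<in> B}) \<partial>M) / (\<integral>\<^sup>+ w. of_nat (N w) \<partial>M))"

inductive_set gen_semigroup :: "'d::finite rmat set \<Rightarrow> 'd rmat set" for S where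
  one: "mat 1 \<in> gen_semigroup S"
| mult: "a \<in> gen_semigroup S \<Longrightarrow> b \<in> S \<Longrightarrow> a ** b \<in> gen_semigroup S"

primrec mprod :: "(nat \<Rightarrow> 'd::finite rmat) \<Rightarrow> nat \<Rightarrow> 'd rmat" where
  "mprod x 0 = mat 1"
| "mprod x (Suc n) = x n ** mprod x n"

definition I_mu :: "'d::finite rmat measure \<Rightarrow> real set" where
  "I_mu \<mu> = {s. 0 \<le> s \<and> (\<integral>\<^sup>+ a. ennreal (opnorm a powr s) \<partial>\<mu>) < \<infinity>}"

definition kappa :: "'d::finite rmat measure \<Rightarrow> real \<Rightarrow> real" where
  "kappa \<mu> s = lim (\<lambda>n. (enn2real (\<integral>\<^sup>+ x. ennreal (opnorm (mprod x n) powr s)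
       \<partial>(PiM UNIV (\<lambda>_::nat. \<mu>)))) powr (1 / real n))"

text \<open>Ulam-Harris words (labels from 0), cover sets, level.\<close>
definition cover_set :: "nat list set \<Rightarrow> bool" where
  "cover_set U \<longleftrightarrow> (\<forall>s :: nat \<Rightarrow> nat. \<exists>!k. map s [0..<k] \<in> U)"

definition finite_level :: "nat list set \<Rightarrow> bool" where
  "finite_level U \<longleftrightarrow> (\<exists>L. \<forall>u\<in>U. length u \<le> L)"

text \<open>a_{u|1} a_{u|2} ... a_{u||u|}, where a_{w i} = fam w i.\<close>
definition path_prod :: "(nat list \<Rightarrow> nat \<Rightarrow> 'd::finite rmat) \<Rightarrow> nat list \<Rightarrow> 'd rmat" where
  "path_prod fam u = foldl (\<lambda>P k. P ** fam (take k u) (u ! k)) (mat 1) [0..<length u]"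

end

theory Submission
  imports Defs
begin

text \<open>The support \<open>S\<close> of \<open>Z\<close> is closed, and almost every realisation \<open>(N, A)\<close> satisfies
  \<open>\<Sum>i<N. A i z i \<in> S\<close> for all \<open>z i \<in> S\<close>. By (C4) some \<open>s \<in> (\<alpha>, 1]\<close> has \<open>m(s) < 1\<close>, so, as
  \<open>t \<mapsto> t powr s\<close> is subadditive, \<open>S\<close> contains \<open>0\<close>, is mapped into itself by some strict
  contraction, and is unbounded (otherwise \<open>E |Z| powr s\<close> would be finite and hence \<open>0\<close>). As
  \<open>0 \<in> S\<close>, the finite sums of products \<open>a u z u\<close> over a prefix-free set of words lie in \<open>S\<close>, and so do
  limits of such sums; in particular \<open>S\<close> is invariant under every \<open>g V\<close>.

  For a positive functional \<open>l\<close> the set \<open>l(S)\<close> meets \<open>[(1 - \<epsilon>) t, (1 + \<epsilon>) t]\<close> for all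
  \<open>t > 0\<close>: the contraction brings a large point of \<open>S\<close> to the required scale up to a bounded
  factor, and partial sums over the words of a binary tree with comparable positive letters interpolate,
  since each word contributes an arbitrarily small fraction of the total. Together with the Perron
  asymptotics of \<open>g ^ n\<close> this gives points \<open>z j n \<in> S\<close> with
  \<open>g j ^ n (e j (z j n))\<close> tending to \<open>s j v(g j)\<close>. The matrices \<open>e j\<close> are products along
  distinct branches of the tree; placing them after the powers of \<open>g j\<close> keeps the words of the
  different summands apart even when the \<open>V j\<close> overlap.\<close>

section \<open>Nonnegative matrices and the norms\<close>

lemma l1_nonneg: "0 \<le> l1 x"
  by (simp add: l1_def sum_nonneg)

lemma l1_zero [simp]: "l1 0 = 0"
  by (simp add: l1_def)

lemma l1_eq_0_iff: "l1 x = 0 \<longleftrightarrow> x = 0"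
  by (simp add: l1_def sum_nonneg_eq_0_iff vec_eq_iff)

lemma l1_triangle: "l1 (x + y) \<le> l1 x + l1 y"
  by (simp add: l1_def sum.distrib[symmetric] sum_mono abs_triangle_ineq)

lemma l1_sum_le: "l1 (\<Sum>i\<in>I. f i) \<le> (\<Sum>i\<in>I. l1 (f i))"
proof (cases "finite I")
  case True
  then show ?thesis
    by (induction I rule: finite_induct) (auto intro: order.trans[OF l1_triangle])
qed simp

lemma l1_scaleR: "l1 (c *\<^sub>R x) = \<bar>c\<bar> * l1 x"
  by (simp add: l1_def sum_distrib_left abs_mult)

lemma continuous_on_l1: "continuous_on S l1"
  unfolding l1_def by (intro continuous_intros)

lemma norm_le_l1: "norm x \<le> l1 x"
  unfolding l1_def by (rule norm_le_l1_cart)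

lemma l1_matvec_le_colsum: "l1 (a *v x) \<le> (\<Sum>j\<in>UNIV. (\<Sum>i\<in>UNIV. \<bar>a $ i $ j\<bar>) * \<bar>x $ j\<bar>)"
proof -
  have "l1 (a *v x) \<le> (\<Sum>i\<in>UNIV. \<Sum>j\<in>UNIV. \<bar>a $ i $ j\<bar> * \<bar>x $ j\<bar>)"
    unfolding l1_def matrix_vector_mult_def
    by (auto intro!: sum_mono order.trans[OF sum_abs] simp: abs_mult)
  also have "\<dots> = (\<Sum>j\<in>UNIV. (\<Sum>i\<in>UNIV. \<bar>a $ i $ j\<bar>) * \<bar>x $ j\<bar>)"
    by (subst sum.swap) (simp add: sum_distrib_right)
  finally show ?thesis .
qed

text \<open>\<open>l1 (a *v x)\<close> is at most an average of the column sums with weights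
  \<open>\<bar>x $ j\<bar>\<close>, with equality at coordinate vectors. This closed form shows that
  the supremum is attained and makes \<open>opnorm\<close> nonnegative and measurable.\<close>

lemma opnorm_eq_Max_colsum: "opnorm (a :: 'd::finite rmat) = Max (range (\<lambda>j. \<Sum>i\<in>UNIV. \<bar>a $ i $ j\<bar>))"
  unfolding opnorm_def
proof (rule cSup_eq_maximum)
  let ?c = "\<lambda>j. \<Sum>i\<in>UNIV. \<bar>a $ i $ j\<bar>"
  have "Max (range ?c) \<in> range ?c" by (rule Max_in) auto
  then obtain j where j: "Max (range ?c) = ?c j" by (meson imageE)
  have "l1 (axis j 1 :: real^'d) = 1"
    by (simp add: l1_def axis_def if_distrib[of abs] cong: if_cong)
  moreover have "l1 (a *v axis j 1) = ?c j"
    by (simp add: l1_def matrix_vector_mul_component inner_axis)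
  ultimately show "Max (range ?c) \<in> (\<lambda>x. l1 (a *v x)) ` {x. l1 x = 1}"
    unfolding j by (intro image_eqI[where x = "axis j 1"]) auto
  fix y assume "y \<in> (\<lambda>x. l1 (a *v x)) ` {x. l1 x = 1}"
  then obtain x where x: "l1 x = 1" "y = l1 (a *v x)" by auto
  have "y \<le> (\<Sum>j\<in>UNIV. ?c j * \<bar>x $ j\<bar>)" using l1_matvec_le_colsum x by simp
  also have "\<dots> \<le> (\<Sum>j\<in>UNIV. Max (range ?c) * \<bar>x $ j\<bar>)"
    by (intro sum_mono mult_right_mono Max_ge) auto
  also have "\<dots> = Max (range ?c)" using x(1) by (simp add: l1_def sum_distrib_left[symmetric])
  finally show "y \<le> Max (range ?c)" .
qed

lemma l1_matvec_le: "l1 (a *v x) \<le> opnorm a * l1 x"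
proof -
  have "l1 (a *v x) \<le> (\<Sum>j\<in>UNIV. (\<Sum>i\<in>UNIV. \<bar>a $ i $ j\<bar>) * \<bar>x $ j\<bar>)"
    by (rule l1_matvec_le_colsum)
  also have "\<dots> \<le> (\<Sum>j\<in>UNIV. opnorm a * \<bar>x $ j\<bar>)"
    unfolding opnorm_eq_Max_colsum by (intro sum_mono mult_right_mono Max_ge) auto
  finally show ?thesis by (simp add: l1_def sum_distrib_left)
qed

lemma opnorm_leI:
  assumes "\<And>x. l1 x = 1 \<Longrightarrow> l1 (a *v x) \<le> K" shows "opnorm (a :: 'd::finite rmat) \<le> K"
proof -
  \<comment> \<open>\<open>cSUP_least\<close> asks for a nonempty index set; any coordinate vector
    will do.\<close>
  have "l1 (axis undefined 1 :: real^'d) = 1"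
    by (simp add: l1_def axis_def if_distrib[of abs] cong: if_cong)
  then show ?thesis
    unfolding opnorm_def using assms by (intro cSUP_least) auto
qed

lemma opnorm_nonneg: "0 \<le> opnorm (a :: 'd::finite rmat)"
  unfolding opnorm_eq_Max_colsum
  by (rule order.trans[OF _ Max_ge[of _ "\<Sum>i\<in>UNIV. \<bar>a $ i $ undefined\<bar>"]]) (auto intro: sum_nonneg)

lemma opnorm_mult_le: "opnorm (a ** b) \<le> opnorm a * opnorm (b :: 'd::finite rmat)"
proof (rule opnorm_leI)
  fix x :: "real^'d" assume x: "l1 x = 1"
  have "l1 ((a ** b) *v x) \<le> opnorm a * l1 (b *v x)"
    by (metis l1_matvec_le matrix_vector_mul_assoc)
  also have "\<dots> \<le> opnorm a * (opnorm b * l1 x)"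
    by (intro mult_left_mono l1_matvec_le opnorm_nonneg)
  finally show "l1 ((a ** b) *v x) \<le> opnorm a * opnorm b" using x by simp
qed

lemma opnorm_measurable [measurable]: "(opnorm :: 'd::finite rmat \<Rightarrow> real) \<in> borel_measurable borel"
proof -
  have "(\<lambda>a::'d rmat. \<bar>a $ i $ j\<bar>) \<in> borel_measurable borel" for i j
    by (intro borel_measurable_continuous_onI continuous_intros)
  then have "(\<lambda>a::'d rmat. Max (range (\<lambda>j. \<Sum>i\<in>UNIV. \<bar>a $ i $ j\<bar>))) \<in> borel_measurable borel"
    by measurable
  then show ?thesis unfolding opnorm_eq_Max_colsum[symmetric] .
qed

lemma continuous_matmul [continuous_intros]:
  fixes f g :: "'a::topological_space \<Rightarrow> 'd::finite rmat"
  assumes "continuous_on S f" "continuous_on S g"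
  shows "continuous_on S (\<lambda>x. f x ** g x)"
  unfolding matrix_matrix_mult_def using assms by (intro continuous_intros)

lemma continuous_matvec:
  fixes f :: "'a::topological_space \<Rightarrow> 'd::finite rmat"
  assumes "continuous_on S f" "continuous_on S g"
  shows "continuous_on S (\<lambda>x. f x *v g x)"
  unfolding matrix_vector_mult_def using assms by (intro continuous_intros)

lemma tendsto_matvec [tendsto_intros]:
  fixes f :: "'a \<Rightarrow> 'd::finite rmat"
  assumes "(f \<longlongrightarrow> a) F" "(g \<longlongrightarrow> x) F"
  shows "((\<lambda>w. f w *v g w) \<longlongrightarrow> a *v x) F"
  unfolding matrix_vector_mult_def using assms by (intro tendsto_intros)

lemma measurable_matmul [measurable (raw)]:
  assumes "f \<in> borel_measurable M" "g \<in> borel_measurable M"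
  shows "(\<lambda>x. (f x :: 'd::finite rmat) ** (g x :: 'd rmat)) \<in> borel_measurable M"
  using assms by (rule borel_measurable_continuous_Pair) (intro continuous_intros)

lemma measurable_matvec [measurable (raw)]:
  assumes "f \<in> borel_measurable M" "g \<in> borel_measurable M"
  shows "(\<lambda>x. (f x :: 'd::finite rmat) *v g x) \<in> borel_measurable M"
  using assms by (rule borel_measurable_continuous_Pair) (intro continuous_matvec continuous_intros)

lemma l1_measurable [measurable]: "l1 \<in> borel_measurable borel"
  by (intro borel_measurable_continuous_onI continuous_on_l1)

text \<open>The fractions \<open>a / (a + b)\<close> and \<open>b / (a + b)\<close> lie in the unit
  interval, where raising to a power \<open>s \<le> 1\<close> can only increase them, and they add
  up to 1.\<close>

lemma powr_add_le:
  fixes a b s :: real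
  assumes "0 \<le> a" "0 \<le> b" "0 < s" "s \<le> 1"
  shows "(a + b) powr s \<le> a powr s + b powr s"
proof (cases "a + b = 0")
  case True
  then have "a = 0" "b = 0" using assms by auto
  then show ?thesis by simp
next
  case False
  then have ab: "0 < a + b" using assms by auto
  have *: "x / (a + b) \<le> (x / (a + b)) powr s" if "0 \<le> x" "x \<le> a + b" for x
  proof (cases "x = 0")
    case False
    then show ?thesis using that ab assms powr_mono'[of s 1 "x / (a + b)"] by (simp add: field_simps)
  qed simp
  have "1 = a / (a + b) + b / (a + b)" using ab by (simp flip: add_divide_distrib)
  also have "\<dots> \<le> (a / (a + b)) powr s + (b / (a + b)) powr s"
    using assms by (intro add_mono *) auto
  also have "\<dots> = (a powr s + b powr s) / (a + b) powr s"
    using assms ab by (simp add: powr_divide add_divide_distrib)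
  finally show ?thesis using ab by (simp add: pos_le_divide_eq)
qed

lemma powr_sum_le:
  fixes f :: "'i \<Rightarrow> real"
  assumes "\<And>i. i \<in> I \<Longrightarrow> 0 \<le> f i" "0 < s" "s \<le> 1"
  shows "(\<Sum>i\<in>I. f i) powr s \<le> (\<Sum>i\<in>I. f i powr s)"
  using assms
proof (induction I rule: infinite_finite_induct)
  case (insert i I)
  have "(f i + (\<Sum>i\<in>I. f i)) powr s \<le> f i powr s + (\<Sum>i\<in>I. f i) powr s"
    using insert by (intro powr_add_le sum_nonneg) auto
  then show ?case using insert by force
qed auto

section \<open>Positivity of vectors and matrices\<close>

definition nonneg_vec :: "real ^ 'd::finite \<Rightarrow> bool" where
  "nonneg_vec x \<longleftrightarrow> (\<forall>i. 0 \<le> x $ i)"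

definition pos_vec :: "real ^ 'd::finite \<Rightarrow> bool" where
  "pos_vec x \<longleftrightarrow> (\<forall>i. 0 < x $ i)"

text \<open>The row and column condition of (C2). It is stable under products, and multiplying by
  such a matrix preserves strict positivity of matrices and of functionals.\<close>

definition allowable :: "'d::finite rmat \<Rightarrow> bool" where
  "allowable a \<longleftrightarrow> nonneg_mat a \<and> (\<forall>i. \<exists>j. 0 < a $ i $ j) \<and> (\<forall>j. \<exists>i. 0 < a $ i $ j)"

lemma pos_vec_imp_nonneg: "pos_vec x \<Longrightarrow> nonneg_vec x"
  by (auto simp: nonneg_vec_def pos_vec_def intro: less_imp_le)

lemma pos_mat_imp_nonneg: "pos_mat a \<Longrightarrow> nonneg_mat a"
  by (auto simp: nonneg_mat_def pos_mat_def intro: less_imp_le)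

lemma nonneg_matvec: "nonneg_mat a \<Longrightarrow> nonneg_vec x \<Longrightarrow> nonneg_vec (a *v x)"
  by (auto simp: nonneg_mat_def nonneg_vec_def matrix_vector_mult_def intro!: sum_nonneg)

lemma nonneg_matmul: "nonneg_mat a \<Longrightarrow> nonneg_mat b \<Longrightarrow> nonneg_mat (a ** b)"
  by (auto simp: nonneg_mat_def matrix_matrix_mult_def intro!: sum_nonneg)

lemma pos_matvec:
  assumes "pos_mat a" "nonneg_vec x" "x \<noteq> 0" shows "pos_vec (a *v x)"
  unfolding pos_vec_def
proof
  fix i
  from assms obtain j where "x $ j \<noteq> 0" by (auto simp: vec_eq_iff)
  with assms have "0 < a $ i $ j * x $ j"
    by (auto simp: nonneg_vec_def pos_mat_def less_le)
  also have "\<dots> \<le> (\<Sum>j\<in>UNIV. a $ i $ j * x $ j)"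
    using assms by (intro member_le_sum) (auto simp: nonneg_vec_def pos_mat_def less_imp_le)
  finally show "0 < (a *v x) $ i" by (simp add: matrix_vector_mult_def)
qed

lemma pos_matmul_allowable:
  assumes "pos_mat a" "allowable b" shows "pos_mat (a ** b)"
  unfolding pos_mat_def
proof (intro allI)
  fix i j
  from assms obtain k where "0 < b $ k $ j" by (auto simp: allowable_def)
  with assms have "0 < a $ i $ k * b $ k $ j"
    by (auto simp: pos_mat_def)
  also have "\<dots> \<le> (\<Sum>k\<in>UNIV. a $ i $ k * b $ k $ j)"
    using assms by (intro member_le_sum) (auto simp: allowable_def nonneg_mat_def pos_mat_def less_imp_le)
  finally show "0 < (a ** b) $ i $ j" by (simp add: matrix_matrix_mult_def)
qed

lemma allowable_mult:
  assumes "allowable a" "allowable b" shows "allowable (a ** b)"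
proof -
  have nn: "nonneg_mat a" "nonneg_mat b" using assms by (auto simp: allowable_def)
  have *: "0 < (a ** b) $ i $ j" if "0 < a $ i $ k" "0 < b $ k $ j" for i j k
  proof -
    have "0 < a $ i $ k * b $ k $ j" using that by simp
    also have "\<dots> \<le> (\<Sum>k\<in>UNIV. a $ i $ k * b $ k $ j)"
      using nn by (intro member_le_sum) (auto simp: nonneg_mat_def)
    finally show ?thesis by (simp add: matrix_matrix_mult_def)
  qed
  show ?thesis
    using assms nonneg_matmul[OF nn] unfolding allowable_def by (meson *)
qed

lemma allowable_mat_1: "allowable (mat 1)"
  by (auto simp: allowable_def nonneg_mat_def mat_def)

lemma inner_matvec_nonneg:
  "nonneg_vec l \<Longrightarrow> nonneg_vec x \<Longrightarrow> 0 \<le> l \<bullet> x"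
  by (auto simp: nonneg_vec_def inner_vec_def intro!: sum_nonneg)

lemma inner_mono_vec:
  "nonneg_vec l \<Longrightarrow> (\<And>i. x $ i \<le> y $ i) \<Longrightarrow> l \<bullet> x \<le> l \<bullet> y"
  by (auto simp: nonneg_vec_def inner_vec_def intro!: sum_mono mult_left_mono)

lemma inner_vec_matvec: "l \<bullet> (a *v x) = (transpose a *v l) \<bullet> (x :: real^'d::finite)"
  by (simp add: dot_lmul_matrix)

text \<open>A positive functional stays positive after being pulled back through \<open>b\<close>,
  because no column of \<open>b\<close> vanishes.\<close>

lemma pos_vec_transpose_allowable:
  assumes "pos_vec l" "allowable b" shows "pos_vec (transpose b *v l)"
  unfolding pos_vec_def
proof
  fix j
  from assms obtain i where "0 < b $ i $ j" by (auto simp: allowable_def)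
  with assms have "0 < b $ i $ j * l $ i" by (auto simp: pos_vec_def)
  also have "\<dots> \<le> (\<Sum>i\<in>UNIV. b $ i $ j * l $ i)"
    using assms by (intro member_le_sum) (auto simp: pos_vec_def allowable_def nonneg_mat_def less_imp_le)
  finally show "0 < (transpose b *v l) $ j" by (simp add: matrix_vector_mult_def transpose_def)
qed

lemma pos_mat_allowable: "pos_mat a \<Longrightarrow> allowable a"
  unfolding allowable_def by (auto simp: pos_mat_imp_nonneg) (auto simp: pos_mat_def)

lemma pos_vec_inner_ge_l1:
  assumes "pos_vec l" obtains c where "0 < c" "\<And>x. nonneg_vec x \<Longrightarrow> c * l1 x \<le> l \<bullet> x"
proof
  let ?c = "Min (range (($) l))"
  have "?c \<in> range (($) l)" by (rule Min_in) auto
  then show "0 < ?c" using assms by (auto simp: pos_vec_def)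
  fix x :: "real^'a" assume "nonneg_vec x"
  then show "?c * l1 x \<le> l \<bullet> x"
    by (auto simp: l1_def inner_vec_def sum_distrib_left nonneg_vec_def intro!: sum_mono mult_right_mono)
qed

section \<open>Perron vectors of positive matrices\<close>

lemma pos_vec_nonzero: "pos_vec x \<Longrightarrow> x \<noteq> 0"
  by (auto simp: pos_vec_def)

text \<open>Brouwer's fixed point theorem for the normalised action of \<open>g\<close> on the unit
  simplex. Positivity of \<open>g\<close> keeps the normalising factor nonzero and makes the fixed
  point strictly positive.\<close>

lemma pos_mat_eigenvector:
  fixes g :: "'d::finite rmat"
  assumes g: "pos_mat g"
  obtains r v where "0 < r" "pos_vec v" "l1 v = 1" "g *v v = r *\<^sub>R v"
proof -
  let ?K = "{x :: real^'d. (\<forall>i. 0 \<le> x $ i) \<and> (\<Sum>i\<in>UNIV. x $ i) = 1}"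
  have l1K: "l1 x = 1" "nonneg_vec x" "x \<noteq> 0" if "x \<in> ?K" for x
  proof -
    show *: "l1 x = 1" "nonneg_vec x" using that by (simp_all add: l1_def nonneg_vec_def)
    then show "x \<noteq> 0" using l1_eq_0_iff[of x] by simp
  qed
  have pos: "pos_vec (g *v x)" if "x \<in> ?K" for x
    using pos_matvec[OF g] l1K[OF that] by simp
  have l1pos: "0 < l1 (g *v x)" if "x \<in> ?K" for x
  proof -
    have "g *v x \<noteq> 0" using pos_vec_nonzero[OF pos[OF that]] .
    then show ?thesis using l1_nonneg[of "g *v x"] l1_eq_0_iff[of "g *v x"] by linarith
  qed
  have "closed ?K"
    unfolding Collect_conj_eq Collect_all_eq
    by (intro closed_Int closed_INT ballI closed_Collect_le closed_Collect_eq continuous_intros)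
  moreover have "bounded ?K"
  proof (rule boundedI)
    fix x assume "x \<in> ?K"
    then show "norm x \<le> 1" using norm_le_l1[of x] l1K(1) by auto
  qed
  ultimately have "compact ?K" by (simp add: compact_eq_bounded_closed)
  moreover have "convex ?K"
    unfolding convex_def by (auto simp: sum.distrib sum_distrib_left[symmetric])
  moreover have "axis undefined 1 \<in> ?K"
    by (auto simp: axis_def)
  moreover have "continuous_on ?K (\<lambda>x. (1 / l1 (g *v x)) *\<^sub>R (g *v x))"
    using l1pos
    by (intro continuous_intros continuous_matvec continuous_on_compose2[OF continuous_on_l1]) force+
  moreover have "(\<lambda>x. (1 / l1 (g *v x)) *\<^sub>R (g *v x)) \<in> ?K \<rightarrow> ?K"
  proof
    fix x assume x: "x \<in> ?K"
    have nn: "\<And>i. 0 \<le> (g *v x) $ i" using pos[OF x] by (auto simp: pos_vec_def less_imp_le)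
    then have "(\<Sum>i\<in>UNIV. (g *v x) $ i) = l1 (g *v x)" by (simp add: l1_def)
    then show "(1 / l1 (g *v x)) *\<^sub>R (g *v x) \<in> ?K"
      using nn l1pos[OF x] by (auto simp: sum_divide_distrib[symmetric])
  qed
  ultimately obtain x where x: "x \<in> ?K" "(1 / l1 (g *v x)) *\<^sub>R (g *v x) = x"
    by (elim brouwer) blast+
  have "g *v x = l1 (g *v x) *\<^sub>R x"
    using arg_cong[OF x(2), of "\<lambda>y. l1 (g *v x) *\<^sub>R y"] l1pos[OF x(1)] by simp
  moreover have "pos_vec x"
    using pos[OF x(1)] l1pos[OF x(1)] by (subst x(2)[symmetric]) (auto simp: pos_vec_def)
  ultimately show ?thesis using that[of "l1 (g *v x)" x] l1pos[OF x(1)] l1K(1)[OF x(1)] by auto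
qed

text \<open>The \<open>l1\<close> norm weighted by \<open>l\<close>. It agrees with the functional
  \<open>l\<close> on nonnegative vectors, and for the left Perron eigenvector it shows the
  contraction of \<open>g\<close> on the kernel of \<open>l\<close> after a single step.\<close>

definition wnorm :: "real ^ 'd::finite \<Rightarrow> real ^ 'd \<Rightarrow> real" where
  "wnorm l x = (\<Sum>i\<in>UNIV. l $ i * \<bar>x $ i\<bar>)"

lemma wnorm_triangle: "nonneg_vec l \<Longrightarrow> wnorm l (x + y) \<le> wnorm l x + wnorm l y"
  by (auto simp: wnorm_def nonneg_vec_def sum.distrib[symmetric] distrib_left[symmetric]
      intro!: sum_mono mult_left_mono abs_triangle_ineq)

lemma wnorm_scaleR: "wnorm l (c *\<^sub>R x) = \<bar>c\<bar> * wnorm l x"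
  by (simp add: wnorm_def sum_distrib_left abs_mult mult_ac)

lemma wnorm_eq_inner: "nonneg_vec x \<Longrightarrow> wnorm l x = l \<bullet> x"
  by (simp add: wnorm_def nonneg_vec_def inner_vec_def)

lemma norm_le_wnorm:
  assumes "pos_vec l" obtains c where "0 < c" "\<And>x. norm x \<le> c * wnorm l x"
proof -
  obtain c where c: "0 < c" "\<And>x. nonneg_vec x \<Longrightarrow> c * l1 x \<le> l \<bullet> x"
    using pos_vec_inner_ge_l1[OF assms] by blast
  have "norm x \<le> (1 / c) * wnorm l x" for x
  proof -
    have "c * l1 (\<chi> i. \<bar>x $ i\<bar>) \<le> l \<bullet> (\<chi> i. \<bar>x $ i\<bar>)" by (intro c) (simp add: nonneg_vec_def)
    then have "c * l1 x \<le> wnorm l x" by (simp add: l1_def wnorm_def inner_vec_def)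
    then have "l1 x \<le> (1 / c) * wnorm l x" using c(1) by (simp add: field_simps)
    then show ?thesis using norm_le_l1[of x] by linarith
  qed
  then show ?thesis using that[of "1 / c"] c(1) by auto
qed

text \<open>Subtract from \<open>w\<close> the largest multiple of \<open>v\<close> below it. The
  difference has a zero coordinate and satisfies the same eigenvector equation, whereas
  \<open>g\<close> would make it strictly positive if it were nonzero.\<close>

lemma perron_unique:
  assumes g: "pos_mat g" and v: "pos_vec v" "g *v v = r *\<^sub>R v" and w: "pos_vec w" "g *v w = r *\<^sub>R w"
    and "l1 v = 1" "l1 w = 1"
  shows "w = (v :: real^'d::finite)"
proof -
  let ?q = "\<lambda>i. w $ i / v $ i"
  define t where "t = Min (range ?q)"
  have "t \<in> range ?q" unfolding t_def by (rule Min_in) auto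
  then obtain i where i: "t = ?q i" by (meson imageE)
  have le: "t \<le> ?q j" for j unfolding t_def by (intro Min_le) auto
  have nn: "nonneg_vec (w - t *\<^sub>R v)"
    using le v(1) by (auto simp: nonneg_vec_def pos_vec_def field_simps)
  have vi: "0 < v $ i" using v(1) by (simp add: pos_vec_def)
  then have z: "(w - t *\<^sub>R v) $ i = 0" using i by simp
  have "g *v (w - t *\<^sub>R v) = r *\<^sub>R (w - t *\<^sub>R v)"
    by (simp add: matrix_vector_mult_diff_distrib matrix_vector_mult_scaleR v w algebra_simps)
  then have "\<not> pos_vec (g *v (w - t *\<^sub>R v))" using z by (auto simp: pos_vec_def intro!: exI[of _ i])
  then have "w = t *\<^sub>R v" using pos_matvec[OF g nn] by auto
  moreover from this have "t = 1"
  proof -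
    have "0 < t" using i vi w(1) by (simp add: pos_vec_def)
    then show ?thesis using assms(6,7) l1_scaleR[of t v] \<open>w = t *\<^sub>R v\<close> by simp
  qed
  ultimately show ?thesis by simp
qed

text \<open>A minorisation argument: entrywise \<open>g\<close> dominates \<open>c * r\<close> times
  the rank-one matrix built from \<open>v\<close> and \<open>l\<close>. Hence \<open>g\<close>
  contracts the kernel of \<open>l\<close> by the factor \<open>1 - c\<close> relative to the Perron
  growth \<open>r\<close>, and \<open>y\<close> differs from \<open>(l \<bullet> y)\<close> times
  \<open>v\<close> by a vector of that kernel.\<close>

theorem perron_asymptotics:
  fixes g :: "'d::finite rmat"
  assumes g: "pos_mat g"
  obtains r l c where "0 < r" "pos_vec l" "pos_vec (perron_vec g)" "l \<bullet> perron_vec g = 1"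
    "0 < c" "c \<le> 1"
    "\<And>n y. nonneg_vec y \<Longrightarrow>
       wnorm l (((*v) g ^^ n) y - (r ^ n * (l \<bullet> y)) *\<^sub>R perron_vec g) \<le> 2 * (1 - c) ^ n * (r ^ n * (l \<bullet> y))"
proof -
  obtain r v where r: "0 < r" and v: "pos_vec v" "l1 v = 1" "g *v v = r *\<^sub>R v"
    using pos_mat_eigenvector[OF g] .
  have "pos_mat (transpose g)" using g by (simp add: pos_mat_def transpose_def)
  then obtain r' l0 where r': "0 < r'" and l0: "pos_vec l0" "transpose g *v l0 = r' *\<^sub>R l0"
    using pos_mat_eigenvector by metis
  obtain b where b: "0 < b" "\<And>x. nonneg_vec x \<Longrightarrow> b * l1 x \<le> l0 \<bullet> x"
    using pos_vec_inner_ge_l1[OF l0(1)] by blast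
  have l0v: "0 < l0 \<bullet> v" using b(2)[of v] b(1) v pos_vec_imp_nonneg by fastforce
  \<comment> \<open>Evaluating \<open>l0 \<bullet> (g *v v)\<close> in two ways shows that the left
    and right eigenvalues agree.\<close>
  have "r' * (l0 \<bullet> v) = r * (l0 \<bullet> v)"
    using inner_vec_matvec[of l0 g v] by (simp only: l0 v inner_scaleR_left inner_scaleR_right)
  then have rr: "r' = r" using l0v by simp
  define l where "l = (1 / (l0 \<bullet> v)) *\<^sub>R l0"
  have l: "pos_vec l" "transpose g *v l = r *\<^sub>R l" "l \<bullet> v = 1"
    using l0 l0v rr by (auto simp: l_def pos_vec_def matrix_vector_mult_scaleR simp del: transpose_matrix_vector)
  have lg: "l \<bullet> (g *v x) = r * (l \<bullet> x)" for x
    by (simp only: inner_vec_matvec l inner_scaleR_left)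
  have nnl: "nonneg_vec l" using l(1) by (rule pos_vec_imp_nonneg)
  have gij: "0 < g $ i $ j" "0 < v $ i" "0 < l $ i" for i j
    using g v l by (auto simp: pos_mat_def pos_vec_def)

  \<comment> \<open>\<open>r\<close> is attained at \<open>v\<close>. For any complex eigenvector,
    the vector \<open>y\<close> of moduli satisfies \<open>q * y \<le> g *v y\<close>
    coordinatewise; pairing with \<open>l\<close> gives \<open>q \<le> r\<close>.\<close>
  have spec: "spec_rad g = r"
    unfolding spec_rad_def
  proof (rule cSup_eq_maximum)
    let ?v = "(\<chi> i. complex_of_real (v $ i)) :: complex^'d"
    have "?v \<noteq> 0" using pos_vec_nonzero[OF v(1)] by (auto simp: vec_eq_iff)
    moreover have "(\<Sum>j\<in>UNIV. complex_of_real (g $ i $ j) * ?v $ j) = complex_of_real r * ?v $ i" for i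
      using arg_cong[OF v(3), of "\<lambda>x. complex_of_real (x $ i)"] by (simp add: matrix_vector_mult_def)
    ultimately show "r \<in> {cmod k | k. \<exists>v :: complex ^ 'd. v \<noteq> 0 \<and>
      (\<chi> i. \<Sum>j\<in>UNIV. complex_of_real (g $ i $ j) * v $ j) = (\<chi> i. k * v $ i)}"
      using r by (intro CollectI exI[of _ "complex_of_real r"] conjI exI[of _ ?v]) (auto simp: vec_eq_iff)
  next
    fix q assume "q \<in> {cmod k | k. \<exists>v :: complex ^ 'd. v \<noteq> 0 \<and>
      (\<chi> i. \<Sum>j\<in>UNIV. complex_of_real (g $ i $ j) * v $ j) = (\<chi> i. k * v $ i)}"
    then obtain k and x :: "complex^'d" where q: "q = cmod k" and "x \<noteq> 0"
      and eq: "\<And>i. (\<Sum>j\<in>UNIV. complex_of_real (g $ i $ j) * x $ j) = k * x $ i"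
      by (auto simp: vec_eq_iff)
    define y :: "real^'d" where "y = (\<chi> i. cmod (x $ i))"
    have y: "nonneg_vec y" "y \<noteq> 0" using \<open>x \<noteq> 0\<close> by (auto simp: y_def nonneg_vec_def vec_eq_iff)
    have "(q *\<^sub>R y) $ i \<le> (g *v y) $ i" for i
    proof -
      have "(q *\<^sub>R y) $ i = cmod (\<Sum>j\<in>UNIV. complex_of_real (g $ i $ j) * x $ j)"
        by (simp add: q y_def eq norm_mult)
      also have "\<dots> \<le> (\<Sum>j\<in>UNIV. cmod (complex_of_real (g $ i $ j) * x $ j))" by (rule norm_sum)
      also have "\<dots> = (g *v y) $ i" using gij(1)
        by (simp add: matrix_vector_mult_def y_def norm_mult less_imp_le abs_of_pos)
      finally show ?thesis .
    qed
    then have "l \<bullet> (q *\<^sub>R y) \<le> l \<bullet> (g *v y)" by (rule inner_mono_vec[OF nnl])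
    then have "q * (l \<bullet> y) \<le> r * (l \<bullet> y)" by (simp add: lg)
    moreover have "0 < l \<bullet> y"
    proof -
      obtain b where b: "0 < b" "\<And>x. nonneg_vec x \<Longrightarrow> b * l1 x \<le> l \<bullet> x"
        using pos_vec_inner_ge_l1[OF l(1)] by blast
      have "0 < l1 y" using y(2) l1_nonneg[of y] l1_eq_0_iff[of y] by linarith
      then show ?thesis using b(2)[OF y(1)] mult_pos_pos[OF b(1)] by fastforce
    qed
    ultimately show "q \<le> r" by simp
  qed
  have pv: "perron_vec g = v"
    unfolding perron_vec_def spec
  proof (rule the_equality)
    show "(\<forall>i. 0 < v $ i) \<and> l1 v = 1 \<and> g *v v = r *\<^sub>R v" using v by (simp add: pos_vec_def)
    show "w = v" if "(\<forall>i. 0 < w $ i) \<and> l1 w = 1 \<and> g *v w = r *\<^sub>R w" for w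
      by (rule perron_unique[OF g, of v r w]) (use that v in \<open>auto simp: pos_vec_def\<close>)
  qed

  \<comment> \<open>The best constant in the rank-one minorisation, capped at 1 so that
    \<open>1 - c\<close> is nonnegative.\<close>
  define c where "c = min 1 (Min (range (\<lambda>(i, j). g $ i $ j / (r * v $ i * l $ j))))"
  have "Min (range (\<lambda>(i, j). g $ i $ j / (r * v $ i * l $ j))) \<in> range (\<lambda>(i, j). g $ i $ j / (r * v $ i * l $ j))"
    by (rule Min_in) auto
  then have c0: "0 < c" "c \<le> 1" using gij r by (auto simp: c_def)
  have cle: "0 \<le> g $ i $ j - c * r * v $ i * l $ j" for i j
  proof -
    have "c \<le> Min (range (\<lambda>(i, j). g $ i $ j / (r * v $ i * l $ j)))" unfolding c_def by simp
    also have "\<dots> \<le> g $ i $ j / (r * v $ i * l $ j)"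
      by (rule Min_le) (auto intro!: image_eqI[where x = "(i, j)"])
    finally show ?thesis using gij r by (simp add: pos_le_divide_eq mult_ac)
  qed

  \<comment> \<open>On the kernel of \<open>l\<close> the rank-one part acts as zero, so
    \<open>g\<close> can be replaced there by the nonnegative remainder, under which
    \<open>l\<close> grows only by \<open>(1 - c) * r\<close>.\<close>
  have step: "wnorm l (g *v x) \<le> (1 - c) * r * wnorm l x" if x: "l \<bullet> x = 0" for x
  proof -
    let ?a = "\<chi> i. \<bar>x $ i\<bar>"
    have wx: "wnorm l x = l \<bullet> ?a" by (simp add: wnorm_def inner_vec_def)
    have "\<bar>(g *v x) $ i\<bar> \<le> (g *v ?a) $ i - c * r * v $ i * (l \<bullet> ?a)" for i
    proof -
      have "(\<Sum>j\<in>UNIV. (g $ i $ j - c * r * v $ i * l $ j) * x $ j) = (g *v x) $ i - c * r * v $ i * (l \<bullet> x)"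
        by (simp add: matrix_vector_mult_def inner_vec_def sum_subtractf algebra_simps sum_distrib_left)
      then have "(g *v x) $ i = (\<Sum>j\<in>UNIV. (g $ i $ j - c * r * v $ i * l $ j) * x $ j)" using x by simp
      then have "\<bar>(g *v x) $ i\<bar> \<le> (\<Sum>j\<in>UNIV. \<bar>(g $ i $ j - c * r * v $ i * l $ j) * x $ j\<bar>)"
        by (simp only: sum_abs)
      also have "\<dots> = (\<Sum>j\<in>UNIV. (g $ i $ j - c * r * v $ i * l $ j) * \<bar>x $ j\<bar>)"
        using cle by (simp add: abs_mult abs_of_nonneg)
      also have "\<dots> = (g *v ?a) $ i - c * r * v $ i * (l \<bullet> ?a)"
        by (simp add: matrix_vector_mult_def inner_vec_def sum_subtractf algebra_simps sum_distrib_left)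
      finally show ?thesis .
    qed
    then have "wnorm l (g *v x) \<le> (\<Sum>i\<in>UNIV. l $ i * ((g *v ?a) $ i - c * r * v $ i * (l \<bullet> ?a)))"
      unfolding wnorm_def using gij(3) by (intro sum_mono mult_left_mono) (auto simp: less_imp_le)
    also have "\<dots> = l \<bullet> (g *v ?a) - c * r * (l \<bullet> ?a) * (l \<bullet> v)"
      by (simp add: inner_vec_def[of l "g *v ?a"] inner_vec_def[of l v] sum_subtractf algebra_simps sum_distrib_left)
    also have "\<dots> = (1 - c) * r * wnorm l x" by (simp add: lg l(3) wx algebra_simps)
    finally show ?thesis .
  qed
  have iter: "l \<bullet> (((*v) g ^^ n) x) = 0 \<and> wnorm l (((*v) g ^^ n) x) \<le> ((1 - c) * r) ^ n * wnorm l x"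
    if x: "l \<bullet> x = 0" for n x
  proof (induction n)
    case (Suc n)
    have "wnorm l (g *v (((*v) g ^^ n) x)) \<le> (1 - c) * r * wnorm l (((*v) g ^^ n) x)"
      using Suc by (intro step) simp
    also have "\<dots> \<le> (1 - c) * r * (((1 - c) * r) ^ n * wnorm l x)"
      using Suc c0 r by (intro mult_left_mono) auto
    finally show ?case using Suc by (simp add: lg mult_ac)
  qed (use x in simp)
  have lin: "((*v) g ^^ n) (y - t *\<^sub>R v) = ((*v) g ^^ n) y - (r ^ n * t) *\<^sub>R v" for n y t
  proof (induction n)
    case (Suc n)
    then show ?case
      by (simp add: matrix_vector_mult_diff_distrib matrix_vector_mult_scaleR v mult_ac)
  qed simp
  show ?thesis
  proof (rule that[of r l c])
    fix n and y :: "real^'d" assume y: "nonneg_vec y"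
    \<comment> \<open>Source of the factor 2: both \<open>y\<close> and its projection have
      \<open>wnorm\<close> equal to \<open>l \<bullet> y\<close>.\<close>
    have "wnorm l (y - (l \<bullet> y) *\<^sub>R v) \<le> wnorm l y + wnorm l (- (l \<bullet> y) *\<^sub>R v)"
      using wnorm_triangle[OF nnl, of y "- (l \<bullet> y) *\<^sub>R v"] by simp
    also have "\<dots> = 2 * (l \<bullet> y)"
      using wnorm_eq_inner[OF y, of l] wnorm_eq_inner[OF pos_vec_imp_nonneg[OF v(1)], of l]
        wnorm_scaleR[of l "- (l \<bullet> y)" v] inner_matvec_nonneg[OF nnl y] l(3) by simp
    finally have "((1 - c) * r) ^ n * wnorm l (y - (l \<bullet> y) *\<^sub>R v) \<le> ((1 - c) * r) ^ n * (2 * (l \<bullet> y))"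
      using c0 r by (intro mult_left_mono) auto
    moreover have "l \<bullet> (y - (l \<bullet> y) *\<^sub>R v) = 0" by (simp add: inner_diff_right l)
    ultimately show "wnorm l (((*v) g ^^ n) y - (r ^ n * (l \<bullet> y)) *\<^sub>R perron_vec g)
        \<le> 2 * (1 - c) ^ n * (r ^ n * (l \<bullet> y))"
      using iter[of "y - (l \<bullet> y) *\<^sub>R v" n] unfolding lin pv by (simp add: power_mult_distrib mult_ac)
  qed (use r l v pv c0 in auto)
qed

section \<open>Sets closed under a branching operation\<close>

lemma matmul_mono_left: "nonneg_mat p \<Longrightarrow> a \<le> b \<Longrightarrow> p ** a \<le> p ** (b :: 'd::finite rmat)"
  by (auto simp: nonneg_mat_def less_eq_vec_def matrix_matrix_mult_def intro!: sum_mono mult_left_mono)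

lemma matmul_mono_right: "nonneg_mat a \<Longrightarrow> p \<le> q \<Longrightarrow> p ** a \<le> q ** (a :: 'd::finite rmat)"
  by (auto simp: nonneg_mat_def less_eq_vec_def matrix_matrix_mult_def intro!: sum_mono mult_right_mono)

lemma matvec_mono: "nonneg_vec x \<Longrightarrow> p \<le> q \<Longrightarrow> p *v x \<le> q *v x"
  by (auto simp: nonneg_vec_def less_eq_vec_def matrix_vector_mult_def intro!: sum_mono mult_right_mono)

text \<open>\<open>c\<close> is the smallest ratio of corresponding entries.\<close>

lemma pos_mat_comparable:
  fixes p q :: "'d::finite rmat"
  assumes "pos_mat p" "pos_mat q"
  obtains c where "0 < c" "c *\<^sub>R q \<le> p"
proof -
  define c where "c = Min (range (\<lambda>(i, j). p $ i $ j / q $ i $ j))"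
  have "c \<in> range (\<lambda>(i, j). p $ i $ j / q $ i $ j)" unfolding c_def by (rule Min_in) auto
  then have "0 < c" using assms by (auto simp: pos_mat_def)
  moreover have "c *\<^sub>R q \<le> p"
  proof -
    have "c \<le> p $ i $ j / q $ i $ j" for i j
      unfolding c_def by (rule Min_le) (auto intro!: image_eqI[where x = "(i, j)"])
    then show ?thesis using assms by (auto simp: less_eq_vec_def pos_mat_def pos_le_divide_eq)
  qed
  ultimately show ?thesis using that by blast
qed

lemma sum_lessThan_add:
  fixes f :: "nat \<Rightarrow> 'a::comm_monoid_add"
  shows "(\<Sum>i<n + m. f i) = (\<Sum>i<n. f i) + (\<Sum>i<m. f (n + i))"
  by (induction m) (simp_all add: add.assoc)

lemma matmul_sum_right: "p ** (\<Sum>i\<in>I. f i) = (\<Sum>i\<in>I. p ** f i)"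
  for p :: "'d::finite rmat"
proof (cases "finite I")
  case True
  then show ?thesis by (induction I rule: finite_induct) (simp_all add: matrix_add_ldistrib)
qed simp

lemma matvec_sum_right: "p *v (\<Sum>i\<in>I. f i) = (\<Sum>i\<in>I. p *v f i)"
  for p :: "'d::finite rmat"
proof (cases "finite I")
  case True
  then show ?thesis by (induction I rule: finite_induct) (simp_all add: matrix_vector_right_distrib)
qed simp

lemma matvec_sum_left: "(\<Sum>i\<in>I. f i) *v x = (\<Sum>i\<in>I. f i *v x)"
  for x :: "real^'d::finite"
proof (cases "finite I")
  case True
  then show ?thesis by (induction I rule: finite_induct) (simp_all add: matrix_vector_mult_add_rdistrib)
qed simp

lemma matrix_add_rdistrib': "(a + b) ** c = a ** c + b ** (c :: 'd::finite rmat)"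
  by (simp add: matrix_matrix_mult_def vec_eq_iff sum.distrib distrib_right)

text \<open>The deterministic half of the argument, for a closed set in place of the support.
  \<open>b1\<close> and \<open>b2\<close> stand for two letters of one realisation,
  \<open>d0\<close> for a strictly contracting product of letters.\<close>

locale branching_set =
  fixes S :: "(real^'d::finite) set" and b1 b2 d0 :: "'d rmat"
  assumes closed_S: "closed S"
    and zero_S: "0 \<in> S"
    and nonneg_S: "x \<in> S \<Longrightarrow> nonneg_vec x"
    and unbounded_S: "\<exists>x\<in>S. K \<le> l1 x"
    and branch: "x \<in> S \<Longrightarrow> y \<in> S \<Longrightarrow> b1 *v x + b2 *v y \<in> S"
    and allow_b: "allowable b1" "allowable b2"
    and contr: "x \<in> S \<Longrightarrow> d0 *v x \<in> S"
    and allow_d: "allowable d0"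
    and d_less_1: "opnorm d0 < 1"
begin

text \<open>The \<open>e j\<close> are the leaves of a comb: each step puts \<open>b1\<close> in
  front of the earlier leaves and adds \<open>b2\<close> as a new one. No leaf word is a prefix of
  another.\<close>

lemma branch_many:
  "\<exists>e. (\<forall>j. allowable (e j)) \<and> (\<forall>z. (\<forall>j<k. z j \<in> S) \<longrightarrow> (\<Sum>j<k. e j *v z j) \<in> S)"
  for k :: nat
proof (induction k)
  case 0
  show ?case using allowable_mat_1 zero_S by auto
next
  case (Suc k)
  then obtain e where e: "\<And>j. allowable (e j)" "\<And>z. (\<forall>j<k. z j \<in> S) \<Longrightarrow> (\<Sum>j<k. e j *v z j) \<in> S"
    by blast
  let ?e = "\<lambda>j. if j < k then b1 ** e j else b2"
  have "(\<Sum>j<Suc k. ?e j *v z j) \<in> S" if "\<forall>j<Suc k. z j \<in> S" for z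
  proof -
    have "(\<Sum>j<Suc k. ?e j *v z j) = b1 *v (\<Sum>j<k. e j *v z j) + b2 *v z k"
      by (simp add: matvec_sum_right matrix_vector_mul_assoc)
    then show ?thesis using that e(2)[of z] branch by auto
  qed
  moreover have "allowable (?e j)" for j using e(1) allow_b allowable_mult by auto
  ultimately show ?case by (intro exI[of _ ?e]) simp
qed

text \<open>The \<open>d i\<close> are the products over the leaves of a tree. Each is at most the
  fraction \<open>1 / K\<close> of the total, and letting \<open>d0\<close> act before the total
  costs at most the factor \<open>\<delta>\<close>. Fineness requires large \<open>K\<close> while
  \<open>\<delta>\<close> stays fixed.\<close>

definition fine_family :: "real \<Rightarrow> real \<Rightarrow> nat \<Rightarrow> (nat \<Rightarrow> 'd rmat) \<Rightarrow> bool" where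
  "fine_family K \<delta> n d \<longleftrightarrow> (\<forall>i<n. nonneg_mat (d i)) \<and>
     (\<forall>z. (\<forall>i<n. z i \<in> S) \<longrightarrow> (\<Sum>i<n. d i *v z i) \<in> S) \<and>
     (\<forall>i<n. K *\<^sub>R d i \<le> (\<Sum>i<n. d i)) \<and>
     \<delta> *\<^sub>R (\<Sum>i<n. d i) \<le> (\<Sum>i<n. d i) ** d0 \<and> pos_mat (\<Sum>i<n. d i)"

text \<open>The products over words of length \<open>m\<close> in two comparable letters: changing the first letter
  changes a product by a bounded factor only, so each product is exponentially small relative to the sum.\<close>

lemma fine_family_exists:
  assumes p: "pos_mat p1" "pos_mat p2"
    and cl: "\<And>x y. x \<in> S \<Longrightarrow> y \<in> S \<Longrightarrow> p1 *v x + p2 *v y \<in> S"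
  obtains c c' where "0 < c" "0 < c'"
    "\<And>m::nat. \<exists>n d. fine_family ((1 + c) ^ m) c' n d"
proof -
  obtain c1 where c1: "0 < c1" "c1 *\<^sub>R p2 \<le> p1" using pos_mat_comparable p by blast
  obtain c2 where c2: "0 < c2" "c2 *\<^sub>R p1 \<le> p2" using pos_mat_comparable p by blast
  \<comment> \<open>Every word constructed below ends in \<open>p1\<close>, so a single comparison
    of \<open>p1 ** d0\<close> with \<open>p1\<close> gives a constant valid at all depths.\<close>
  obtain c' where c': "0 < c'" "c' *\<^sub>R p1 \<le> p1 ** d0"
    using pos_mat_comparable[OF pos_matmul_allowable[OF p(1) allow_d] p(1)] .
  define c where "c = min c1 c2"
  have c: "0 < c" using c1 c2 by (simp add: c_def)
  have nn: "nonneg_mat p1" "nonneg_mat p2" using p pos_mat_imp_nonneg by auto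
  have "c *\<^sub>R p2 \<le> c1 *\<^sub>R p2" "c *\<^sub>R p1 \<le> c2 *\<^sub>R p1"
    using nn by (auto simp: c_def less_eq_vec_def nonneg_mat_def intro: mult_right_mono)
  then have le: "c *\<^sub>R p2 \<le> p1" "c *\<^sub>R p1 \<le> p2" using c1 c2 by (auto intro: order.trans)
  have "\<exists>n d. fine_family ((1 + c) ^ m) c' n d" for m :: nat
  proof (induction m)
    case 0
    have "p1 *v x \<in> S" if "x \<in> S" for x using cl[OF that zero_S] by simp
    then show ?case using p nn c' by (intro exI[of _ 1] exI[of _ "\<lambda>_. p1"]) (auto simp: fine_family_def)
  next
    case (Suc m)
    then obtain n d where fine: "fine_family ((1 + c) ^ m) c' n d" by blast
    define P where P: "P = (\<Sum>i<n. d i)"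
    from fine have d: "\<And>i. i < n \<Longrightarrow> nonneg_mat (d i)"
      and clo: "\<And>z. (\<forall>i<n. z i \<in> S) \<Longrightarrow> (\<Sum>i<n. d i *v z i) \<in> S"
      and small: "\<And>i. i < n \<Longrightarrow> (1 + c) ^ m *\<^sub>R d i \<le> P" and P': "c' *\<^sub>R P \<le> P ** d0" "pos_mat P"
      unfolding fine_family_def P[symmetric] by auto
    have nnP: "nonneg_mat P" using P'(2) by (rule pos_mat_imp_nonneg)
    \<comment> \<open>Indices below \<open>n\<close> hold the words starting with \<open>p1\<close>,
      the next \<open>n\<close> those starting with \<open>p2\<close>.\<close>
    let ?d = "\<lambda>i. if i < n then p1 ** d i else p2 ** d (i - n)"
    let ?P = "p1 ** P + p2 ** P"
    have F1: "?P = (\<Sum>i<n + n. ?d i)"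
      unfolding sum_lessThan_add by (simp add: P matmul_sum_right)
    have F2: "nonneg_mat (?d i)" if "i < n + n" for i
      using that d nn by (auto intro!: nonneg_matmul)
    have F3: "(\<Sum>i<n + n. ?d i *v z i) \<in> S" if z: "\<forall>i<n + n. z i \<in> S" for z
    proof -
      have "(\<Sum>i<n + n. ?d i *v z i) = p1 *v (\<Sum>i<n. d i *v z i) + p2 *v (\<Sum>i<n. d i *v z (n + i))"
        unfolding sum_lessThan_add by (simp add: matvec_sum_right matrix_vector_mul_assoc)
      then show ?thesis using z clo[of z] clo[of "\<lambda>i. z (n + i)"] cl by auto
    qed
    have F4: "(1 + c) ^ Suc m *\<^sub>R ?d i \<le> ?P" if i: "i < n + n" for i
    proof -
      \<comment> \<open>The words with the other first letter \<open>q'\<close> contribute at least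
        \<open>c\<close> times the contribution of those with \<open>q\<close>: each level of the
        tree gains a factor \<open>1 + c\<close>.\<close>
      have *: "(1 + c) ^ Suc m *\<^sub>R (q ** d i) \<le> q ** P + q' ** P"
        if "i < n" "c *\<^sub>R q \<le> q'" "nonneg_mat q" for i q q'
      proof -
        have "(1 + c) ^ Suc m *\<^sub>R (q ** d i) = (1 + c) *\<^sub>R (q ** ((1 + c) ^ m *\<^sub>R d i))"
          by (simp add: matrix_scalar_ac flip: scalar_matrix_assoc)
        also have "\<dots> \<le> (1 + c) *\<^sub>R (q ** P)"
          using small[OF that(1)] that(3) c by (intro scaleR_left_mono matmul_mono_left) auto
        also have "\<dots> = q ** P + (c *\<^sub>R q) ** P"
          by (simp add: scaleR_left_distrib matrix_add_rdistrib' flip: scalar_matrix_assoc)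
        also have "\<dots> \<le> q ** P + q' ** P"
          using that nnP by (intro add_left_mono matmul_mono_right)
        finally show ?thesis .
      qed
      show ?thesis
        using *[of i p1 p2] *[of "i - n" p2 p1] i le nn by (auto simp: add.commute)
    qed
    have F5: "c' *\<^sub>R ?P \<le> ?P ** d0"
    proof -
      have "c' *\<^sub>R ?P = p1 ** (c' *\<^sub>R P) + p2 ** (c' *\<^sub>R P)"
        by (simp add: matrix_scalar_ac scaleR_right_distrib flip: scalar_matrix_assoc)
      also have "\<dots> \<le> p1 ** (P ** d0) + p2 ** (P ** d0)"
        using P' nn by (intro add_mono matmul_mono_left)
      also have "\<dots> = ?P ** d0"
        by (simp add: matrix_mul_assoc matrix_add_rdistrib')
      finally show ?thesis .
    qed
    have F6: "pos_mat ?P"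
      using pos_matmul_allowable[OF p(1) pos_mat_allowable[OF P'(2)]]
        pos_matmul_allowable[OF p(2) pos_mat_allowable[OF P'(2)]] by (simp add: pos_mat_def add_pos_pos)
    show ?case
      by (intro exI[of _ "n + n"] exI[of _ ?d])
        (unfold fine_family_def F1[symmetric], intro conjI allI[OF impI[OF F2]] allI[OF impI[OF F3]]
          allI[OF impI[OF F4]] F5 F6)
  qed
  then show ?thesis by (intro that[OF c c'(1)])
qed

text \<open>Powers of \<open>d0\<close> move a large point of \<open>S\<close> to some
  \<open>z\<close> for which the total \<open>l \<bullet> (P *v z)\<close> is at least
  \<open>t\<close> but below \<open>t / c'\<close>. Adding up the contributions of the words one at
  a time then crosses \<open>t\<close> in steps of size at most
  \<open>\<epsilon> * t\<close>.\<close>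

lemma all_scales:
  assumes p: "pos_mat p1" "pos_mat p2"
    and cl: "\<And>x y. x \<in> S \<Longrightarrow> y \<in> S \<Longrightarrow> p1 *v x + p2 *v y \<in> S"
    and l: "pos_vec l" and t: "0 < t" and eps: "0 < \<epsilon>"
  shows "\<exists>z\<in>S. \<bar>l \<bullet> z - t\<bar> \<le> \<epsilon> * t"
proof -
  obtain c c' where c: "0 < c" "0 < c'" and fam: "\<And>m::nat. \<exists>n d. fine_family ((1 + c) ^ m) c' n d"
    using fine_family_exists[OF p cl] by blast
  \<comment> \<open>One word is to carry less than the fraction \<open>c' * \<epsilon>\<close> of
    the total; the factor \<open>c'\<close> absorbs the possible excess of the total over
    \<open>t\<close>.\<close>
  obtain m where m: "1 / (c' * \<epsilon>) < (1 + c) ^ m"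
    using real_arch_pow[of "1 + c" "1 / (c' * \<epsilon>)"] c by auto
  obtain n d where fine: "fine_family ((1 + c) ^ m) c' n d" using fam by blast
  define P where P: "P = (\<Sum>i<n. d i)"
  from fine have d: "\<And>i. i < n \<Longrightarrow> nonneg_mat (d i)"
    and clo: "\<And>z. (\<forall>i<n. z i \<in> S) \<Longrightarrow> (\<Sum>i<n. d i *v z i) \<in> S"
    and small: "\<And>i. i < n \<Longrightarrow> (1 + c) ^ m *\<^sub>R d i \<le> P" and P': "c' *\<^sub>R P \<le> P ** d0" "pos_mat P"
    unfolding fine_family_def P[symmetric] by auto
  have nnl: "nonneg_vec l" using l by (rule pos_vec_imp_nonneg)
  obtain \<kappa> where \<kappa>: "0 < \<kappa>" "\<And>x. nonneg_vec x \<Longrightarrow> \<kappa> * l1 x \<le> (transpose P *v l) \<bullet> x"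
    using pos_vec_inner_ge_l1[OF pos_vec_transpose_allowable[OF l pos_mat_allowable[OF P'(2)]]] by blast
  \<comment> \<open>The starting point is large enough for the total to be at least
    \<open>t\<close>; iterating \<open>d0\<close> drives it to \<open>0\<close>.\<close>
  obtain z0 where z0: "z0 \<in> S" "t / \<kappa> \<le> l1 z0" using unbounded_S by blast
  define zs where "zs k = ((*v) d0 ^^ k) z0" for k
  have zS: "zs k \<in> S" for k by (induction k) (auto simp: zs_def z0 contr)
  have L0: "t \<le> l \<bullet> (P *v zs 0)"
  proof -
    have "t \<le> \<kappa> * l1 z0" using z0(2) \<kappa>(1) by (simp add: pos_divide_le_eq mult.commute)
    also have "\<dots> \<le> (transpose P *v l) \<bullet> z0" using z0 nonneg_S by (intro \<kappa>) auto
    finally show ?thesis by (simp only: inner_vec_matvec zs_def funpow_0)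
  qed
  have l1zs: "l1 (zs k) \<le> opnorm d0 ^ k * l1 z0" for k
  proof (induction k)
    case (Suc k)
    have "l1 (zs (Suc k)) \<le> opnorm d0 * l1 (zs k)" by (simp add: zs_def l1_matvec_le)
    also have "\<dots> \<le> opnorm d0 * (opnorm d0 ^ k * l1 z0)" by (intro mult_left_mono Suc opnorm_nonneg)
    finally show ?case by simp
  qed (simp add: zs_def)
  have "(\<lambda>k. opnorm d0 ^ k * l1 z0) \<longlonglongrightarrow> 0 * l1 z0"
    using d_less_1 opnorm_nonneg[of d0] by (intro tendsto_mult LIMSEQ_power_zero tendsto_const) auto
  then have "(\<lambda>k. l1 (zs k)) \<longlonglongrightarrow> 0"
    using l1zs l1_nonneg by (intro tendsto_sandwich[of "\<lambda>_. 0" "\<lambda>k. l1 (zs k)" sequentially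
        "\<lambda>k. opnorm d0 ^ k * l1 z0" 0] always_eventually allI) auto
  then have "zs \<longlonglongrightarrow> 0"
    by (rule Lim_null_comparison[rotated]) (auto simp: norm_le_l1)
  then have "(\<lambda>k. l \<bullet> (P *v zs k)) \<longlonglongrightarrow> l \<bullet> (P *v 0)" by (intro tendsto_intros)
  then have "\<forall>\<^sub>F k in sequentially. l \<bullet> (P *v zs k) < t" using t by (intro order_tendstoD) auto
  then obtain k0 where "l \<bullet> (P *v zs k0) < t" by (auto simp: eventually_sequentially)
  moreover have "\<not> l \<bullet> (P *v zs 0) < t" using L0 by simp
  \<comment> \<open>Stop just before the total first drops below \<open>t\<close>. Since one more
    \<open>d0\<close> loses at most the factor \<open>c'\<close>, the total at \<open>k\<close> is
    still below \<open>t / c'\<close>.\<close>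
  ultimately obtain k where "\<forall>i\<le>k. \<not> l \<bullet> (P *v zs i) < t" and k1: "l \<bullet> (P *v zs (Suc k)) < t"
    using ex_least_nat_less[of "\<lambda>k. l \<bullet> (P *v zs k) < t" k0] by blast
  then have k2: "t \<le> l \<bullet> (P *v zs k)" using not_less by blast
  define z where "z = zs k"
  have z: "z \<in> S" "nonneg_vec z" using zS nonneg_S by (auto simp: z_def)
  have "c' * (l \<bullet> (P *v z)) = l \<bullet> ((c' *\<^sub>R P) *v z)" by (simp add: scaleR_matrix_vector_assoc[symmetric])
  also have "\<dots> \<le> l \<bullet> ((P ** d0) *v z)"
    using matvec_mono[OF z(2) P'(1)] nnl by (intro inner_mono_vec) (auto simp: less_eq_vec_def)
  also have "\<dots> = l \<bullet> (P *v zs (Suc k))" by (simp add: z_def zs_def matrix_vector_mul_assoc)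
  finally have upper: "c' * (l \<bullet> (P *v z)) < t" using k1 by simp
  define x where "x i = l \<bullet> (d i *v z)" for i
  have x0: "0 \<le> x i" if "i < n" for i
    unfolding x_def using d[OF that] z nnl by (intro inner_matvec_nonneg nonneg_matvec)
  have xsmall: "x i \<le> \<epsilon> * t" if "i < n" for i
  proof -
    have "(1 + c) ^ m * x i = l \<bullet> (((1 + c) ^ m *\<^sub>R d i) *v z)"
      by (simp add: x_def scaleR_matrix_vector_assoc[symmetric])
    also have "\<dots> \<le> l \<bullet> (P *v z)"
      using matvec_mono[OF z(2) small[OF that]] nnl by (intro inner_mono_vec) (auto simp: less_eq_vec_def)
    finally have "c' * ((1 + c) ^ m * x i) \<le> c' * (l \<bullet> (P *v z))" using c by (intro mult_left_mono) auto
    then have "c' * ((1 + c) ^ m * x i) < t" using upper by linarith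
    moreover have "1 / (c' * \<epsilon>) * x i \<le> (1 + c) ^ m * x i"
      using m x0[OF that] by (intro mult_right_mono) auto
    then have "c' * (1 / (c' * \<epsilon>) * x i) \<le> c' * ((1 + c) ^ m * x i)" using c by (intro mult_left_mono) auto
    moreover have "c' * (1 / (c' * \<epsilon>) * x i) = x i / \<epsilon>" using c by simp
    ultimately have "x i / \<epsilon> < t" by linarith
    then show ?thesis using eps by (simp add: field_simps)
  qed
  have tot: "t \<le> (\<Sum>i<n. x i)"
    using k2 by (simp add: z_def[symmetric] P matvec_sum_left inner_sum_right x_def)
  moreover have "\<not> t \<le> (\<Sum>i<0. x i)" using t by simp
  ultimately obtain j where "j < n" and "\<forall>i\<le>j. \<not> t \<le> (\<Sum>i<i. x i)" and "t \<le> (\<Sum>i<Suc j. x i)"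
    using ex_least_nat_less[of "\<lambda>j. t \<le> (\<Sum>i<j. x i)" n] by blast
  then have j: "j < n" "(\<Sum>i<j. x i) < t" "t \<le> (\<Sum>i<Suc j. x i)" using not_le by blast+
  \<comment> \<open>The words up to and including the crossing index \<open>j\<close> receive
    \<open>z\<close>, all others receive \<open>0\<close>.\<close>
  define y where "y = (\<Sum>i<n. d i *v (if i < Suc j then z else 0))"
  have "y \<in> S" unfolding y_def using z zero_S by (intro clo) auto
  moreover have "l \<bullet> y = (\<Sum>i<Suc j. x i)"
  proof -
    have "l \<bullet> y = (\<Sum>i<n. if i < Suc j then x i else 0)"
      unfolding y_def inner_sum_right by (intro sum.cong) (auto simp: x_def)
    also have "\<dots> = (\<Sum>i<Suc j. x i)"
      using j(1) by (intro sum.mono_neutral_cong_right) auto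
    finally show ?thesis .
  qed
  ultimately show ?thesis using j xsmall[OF j(1)] by (intro bexI[of _ y]) auto
qed

text \<open>Choose \<open>z n\<close> by \<open>all_scales\<close> with
  \<open>l \<bullet> (e *v z n)\<close> equal to \<open>s / r ^ n\<close> up to a relative error
  tending to 0. Multiplication by \<open>g ^ n\<close> then restores the size \<open>s\<close>, and
  the Perron asymptotics turn the direction into that of \<open>perron_vec g\<close>.\<close>

lemma ray_approx:
  assumes g: "pos_mat g" "\<And>x. x \<in> S \<Longrightarrow> g *v x \<in> S" and e: "allowable e" and s: "0 \<le> s"
  shows "\<exists>z. (\<forall>n. z n \<in> S) \<and> (\<lambda>n. ((*v) g ^^ n) (e *v z n)) \<longlonglongrightarrow> s *\<^sub>R perron_vec g"
proof (cases "s = 0")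
  case True
  have "((*v) g ^^ n) 0 = 0" for n by (induction n) auto
  then show ?thesis using True zero_S by (intro exI[of _ "\<lambda>_. 0"]) simp
next
  case False
  with s have s: "0 < s" by simp
  obtain r l c where r: "0 < r" and l: "pos_vec l" "pos_vec (perron_vec g)" "l \<bullet> perron_vec g = 1"
    and c: "0 < c" "c \<le> 1" and asy: "\<And>n y. nonneg_vec y \<Longrightarrow>
       wnorm l (((*v) g ^^ n) y - (r ^ n * (l \<bullet> y)) *\<^sub>R perron_vec g) \<le> 2 * (1 - c) ^ n * (r ^ n * (l \<bullet> y))"
    using perron_asymptotics[OF g(1)] by blast
  let ?v = "perron_vec g"
  have nnl: "nonneg_vec l" using l(1) by (rule pos_vec_imp_nonneg)
  let ?eps = "\<lambda>n. 1 / real (Suc n)"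
  \<comment> \<open>Putting \<open>g\<close> in front of the two branching letters makes them
    strictly positive, as \<open>all_scales\<close> demands.\<close>
  have cl: "(g ** b1) *v x + (g ** b2) *v y \<in> S" if "x \<in> S" "y \<in> S" for x y
    using g(2)[OF branch[OF that]] by (simp add: matrix_vector_right_distrib matrix_vector_mul_assoc)
  have "\<exists>z\<in>S. \<bar>(transpose e *v l) \<bullet> z - s / r ^ n\<bar> \<le> ?eps n * (s / r ^ n)" for n
    using s r by (intro all_scales[OF _ _ cl] pos_matmul_allowable g allow_b pos_vec_transpose_allowable l e) auto
  then obtain z where z: "\<And>n. z n \<in> S"
    and "\<And>n. \<bar>(transpose e *v l) \<bullet> z n - s / r ^ n\<bar> \<le> ?eps n * (s / r ^ n)" by metis
  then have lz: "\<bar>l \<bullet> (e *v z n) - s / r ^ n\<bar> \<le> ?eps n * (s / r ^ n)" for n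
    by (simp only: inner_vec_matvec)
  have close: "\<bar>r ^ n * (l \<bullet> (e *v z n)) - s\<bar> \<le> ?eps n * s" for n
  proof -
    have "r ^ n * (l \<bullet> (e *v z n)) - s = r ^ n * (l \<bullet> (e *v z n) - s / r ^ n)"
      using r by (simp add: right_diff_distrib)
    then have "\<bar>r ^ n * (l \<bullet> (e *v z n)) - s\<bar> = r ^ n * \<bar>l \<bullet> (e *v z n) - s / r ^ n\<bar>"
      using r by (simp only: abs_mult) simp
    also have "\<dots> \<le> r ^ n * (?eps n * (s / r ^ n))" using r lz by (intro mult_left_mono) auto
    also have "\<dots> = ?eps n * s" using r by simp
    finally show ?thesis .
  qed
  have dec: "wnorm l (((*v) g ^^ n) (e *v z n) - s *\<^sub>R ?v) \<le> 2 * (1 - c) ^ n * (2 * s) + ?eps n * s" for n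
  proof -
    let ?y = "e *v z n"
    let ?q = "r ^ n * (l \<bullet> ?y)"
    have y: "nonneg_vec ?y" using e z nonneg_S by (intro nonneg_matvec) (auto simp: allowable_def)
    have "wnorm l (((*v) g ^^ n) ?y - s *\<^sub>R ?v)
        \<le> wnorm l (((*v) g ^^ n) ?y - ?q *\<^sub>R ?v) + wnorm l ((?q - s) *\<^sub>R ?v)"
      using wnorm_triangle[OF nnl, of "((*v) g ^^ n) ?y - ?q *\<^sub>R ?v" "(?q - s) *\<^sub>R ?v"]
      by (simp add: scaleR_left_diff_distrib)
    also have "wnorm l ((?q - s) *\<^sub>R ?v) = \<bar>?q - s\<bar>"
      by (simp add: wnorm_scaleR wnorm_eq_inner[OF pos_vec_imp_nonneg[OF l(2)]] l(3))
    also have "wnorm l (((*v) g ^^ n) ?y - ?q *\<^sub>R ?v) \<le> 2 * (1 - c) ^ n * ?q" by (rule asy[OF y])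
    also have "\<dots> \<le> 2 * (1 - c) ^ n * (2 * s)"
    proof (intro mult_left_mono)
      have "?eps n * s \<le> 1 * s" using s by (intro mult_right_mono) auto
      then show "?q \<le> 2 * s" using close[of n] by linarith
    qed (use c in auto)
    finally show ?thesis using close[of n] by linarith
  qed
  obtain C where C: "0 < C" "\<And>x. norm x \<le> C * wnorm l x" using norm_le_wnorm[OF l(1)] by blast
  have bound: "norm (((*v) g ^^ n) (e *v z n) - s *\<^sub>R ?v) \<le> C * (2 * (1 - c) ^ n * (2 * s) + ?eps n * s)" for n
    by (rule order.trans[OF C(2) mult_left_mono[OF dec less_imp_le[OF C(1)]]])
  have "(\<lambda>n. C * (2 * (1 - c) ^ n * (2 * s) + ?eps n * s)) \<longlonglongrightarrow> C * (2 * 0 * (2 * s) + 0 * s)"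
    using c by (intro tendsto_intros LIMSEQ_power_zero LIMSEQ_Suc[OF lim_1_over_n[where 'a = real]]) auto
  then have "(\<lambda>n. C * (2 * (1 - c) ^ n * (2 * s) + ?eps n * s)) \<longlonglongrightarrow> 0" by simp
  from Lim_null_comparison[OF always_eventually[OF allI[OF bound]] this]
  have "(\<lambda>n. ((*v) g ^^ n) (e *v z n) - s *\<^sub>R ?v) \<longlonglongrightarrow> 0" .
  then have "(\<lambda>n. ((*v) g ^^ n) (e *v z n)) \<longlonglongrightarrow> s *\<^sub>R ?v" by (rule Lim_null[THEN iffD2])
  with z show ?thesis by blast
qed

text \<open>The assumption \<open>inv\<close> speaks of all subsums because the sets of words behind
  the \<open>g j\<close> may overlap: a word shared by several of them receives the sum of the
  corresponding \<open>y j\<close>. In this form it can be iterated, and the limit of the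
  \<open>n\<close>-th iterates is the required sum of rays.\<close>

lemma sum_rays_in_set:
  fixes k :: nat
  assumes g: "\<And>j. j < k \<Longrightarrow> pos_mat (g j)" and s: "\<And>j. j < k \<Longrightarrow> 0 \<le> s j"
    and inv: "\<And>y. (\<And>J. J \<subseteq> {..<k} \<Longrightarrow> (\<Sum>j\<in>J. y j) \<in> S) \<Longrightarrow>
        (\<And>J. J \<subseteq> {..<k} \<Longrightarrow> (\<Sum>j\<in>J. g j *v y j) \<in> S)"
  shows "(\<Sum>j<k. s j *\<^sub>R perron_vec (g j)) \<in> S"
proof -
  obtain e where e: "\<And>j. allowable (e j)" "\<And>z. (\<forall>j<k. z j \<in> S) \<Longrightarrow> (\<Sum>j<k. e j *v z j) \<in> S"
    using branch_many[of k] by auto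
  \<comment> \<open>A family concentrated at one index reduces \<open>inv\<close> to invariance
    under a single \<open>g j\<close>.\<close>
  have single: "g j *v x \<in> S" if "j < k" "x \<in> S" for j x
  proof -
    have "(\<Sum>i\<in>J. if i = j then x else 0) \<in> S" if "J \<subseteq> {..<k}" for J
    proof -
      have "finite J" using that by (rule finite_subset) simp
      then show ?thesis using \<open>x \<in> S\<close> zero_S by (simp only: sum.delta split: if_split) simp
    qed
    then show ?thesis using inv[of "\<lambda>i. if i = j then x else 0" "{j}"] that by simp
  qed
  have "\<forall>j\<in>{..<k}. \<exists>z. (\<forall>n. z n \<in> S) \<and> (\<lambda>n. ((*v) (g j) ^^ n) (e j *v z n)) \<longlonglongrightarrow> s j *\<^sub>R perron_vec (g j)"
    by (intro ballI ray_approx g single e s) auto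
  from bchoice[OF this] obtain z where z: "\<And>j n. j < k \<Longrightarrow> z j n \<in> S"
    and lim: "\<And>j. j < k \<Longrightarrow> (\<lambda>n. ((*v) (g j) ^^ n) (e j *v z j n)) \<longlonglongrightarrow> s j *\<^sub>R perron_vec (g j)"
    by auto
  \<comment> \<open>The number \<open>m\<close> of iterations is separate from the index
    \<open>n\<close> of the points, so that induction on \<open>m\<close> keeps the starting points
    fixed.\<close>
  have "(\<Sum>j\<in>J. ((*v) (g j) ^^ m) (e j *v z j n)) \<in> S" if "J \<subseteq> {..<k}" for J m n
    using that
  proof (induction m arbitrary: J)
    case 0
    have "(\<Sum>j<k. e j *v (if j \<in> J then z j n else 0)) \<in> S" using z zero_S by (intro e) auto
    also have "(\<Sum>j<k. e j *v (if j \<in> J then z j n else 0)) = (\<Sum>j\<in>J. e j *v z j n)"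
      using 0 by (intro sum.mono_neutral_cong_right) auto
    finally show ?case by simp
  next
    case (Suc m)
    then show ?case using inv[of "\<lambda>j. ((*v) (g j) ^^ m) (e j *v z j n)" J] by simp
  qed
  then have inS: "(\<Sum>j<k. ((*v) (g j) ^^ n) (e j *v z j n)) \<in> S" for n by blast
  have "(\<lambda>n. \<Sum>j<k. ((*v) (g j) ^^ n) (e j *v z j n)) \<longlonglongrightarrow> (\<Sum>j<k. s j *\<^sub>R perron_vec (g j))"
    using lim by (intro tendsto_sum) auto
  from closed_sequentially[OF closed_S inS this] show ?thesis .
qed

end

section \<open>Moments of products and the branching moments\<close>

text \<open>Fekete's lemma: the limit is the infimum of \<open>u n / n\<close>, which is finite and
  nonnegative because \<open>u\<close> is. The upper bound comes from division of \<open>n\<close>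
  by a near-optimal \<open>m\<close> with remainder.\<close>

lemma fekete_nonneg:
  fixes u :: "nat \<Rightarrow> real"
  assumes nonneg: "\<And>n. 0 \<le> u n" and sub: "\<And>m n. u (m + n) \<le> u m + u n"
  obtains L where "0 \<le> L" "(\<lambda>n. u n / n) \<longlonglongrightarrow> L"
proof -
  define L where "L = (INF n\<in>{1..}. u n / real n)"
  have bdd: "bdd_below ((\<lambda>n. u n / real n) ` {1..})"
    using nonneg by (intro bdd_belowI2[of _ 0]) simp
  have L_le: "L \<le> u n / real n" if "1 \<le> n" for n
    unfolding L_def using that by (intro cINF_lower bdd) simp
  have L0: "0 \<le> L" unfolding L_def using nonneg by (intro cINF_greatest) auto
  have mult: "u (q * m + r) \<le> real q * u m + u r" for q m r
  proof (induction q)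
    case (Suc q)
    have "u (Suc q * m + r) \<le> u m + u (q * m + r)" using sub[of m "q * m + r"] by (simp add: add.assoc)
    then show ?case using Suc by (simp add: algebra_simps)
  qed simp
  have "(\<lambda>n. u n / n) \<longlonglongrightarrow> L"
  proof (rule order_tendstoI)
    fix a assume "a < L"
    then have "a < u n / real n" if "1 \<le> n" for n using L_le[OF that] by linarith
    then show "\<forall>\<^sub>F n in sequentially. a < u n / real n"
      by (auto simp: eventually_sequentially intro!: exI[of _ 1])
  next
    fix a assume "L < a"
    then obtain m where m: "1 \<le> m" "u m / real m < a"
      unfolding L_def by (subst (asm) cINF_less_iff) (use bdd in auto)
    define C where "C = Max (u ` {..<m})"
    have C: "u r \<le> C" if "r < m" for r unfolding C_def using that by (intro Max_ge) auto
    have bound: "u n / real n \<le> u m / real m + C / real n" if "1 \<le> n" for n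
    proof -
      have "u n \<le> real (n div m) * u m + u (n mod m)"
        using mult[of "n div m" m "n mod m"] by simp
      also have "\<dots> \<le> real n / real m * u m + C"
      proof (intro add_mono mult_right_mono)
        show "real (n div m) \<le> real n / real m" using m(1) by (simp add: pos_le_divide_eq flip: of_nat_mult)
      qed (use nonneg m(1) C in auto)
      finally show ?thesis using that by (simp add: field_simps)
    qed
    have "(\<lambda>n. u m / real m + C / real n) \<longlonglongrightarrow> u m / real m + 0"
      by (intro tendsto_intros lim_const_over_n)
    then have "\<forall>\<^sub>F n in sequentially. u m / real m + C / real n < a"
      using m by (intro order_tendstoD) auto
    with eventually_ge_at_top[of 1] show "\<forall>\<^sub>F n in sequentially. u n / real n < a"
      by eventually_elim (use bound in force)
  qed
  with L0 show ?thesis using that by blast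
qed

section \<open>Moments of products of i.i.d. matrices\<close>

locale matrix_law = prob_space \<mu> for \<mu> :: "('d::finite rmat) measure" +
  assumes sets_law [measurable_cong, simp]: "sets \<mu> = sets borel"
begin

abbreviation seq_law :: "(nat \<Rightarrow> 'd rmat) measure" where
  "seq_law \<equiv> PiM UNIV (\<lambda>_::nat. \<mu>)"

lemma prob_space_seq_law: "prob_space seq_law"
  by (rule prob_space_PiM) unfold_locales

lemma mprod_measurable [measurable]: "(\<lambda>x. mprod x n) \<in> borel_measurable seq_law"
proof (induction n)
  case (Suc n)
  have "(\<lambda>x. x n) \<in> measurable seq_law borel"
    using measurable_component_singleton[of n UNIV "\<lambda>_. \<mu>"] by (simp cong: measurable_cong_sets)
  with Suc show ?case unfolding mprod.simps by measurable
qed simp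

lemma mprod_cong: "(\<And>i. i < n \<Longrightarrow> x i = y i) \<Longrightarrow> mprod x n = mprod y n"
  by (induction n) auto

text \<open>\<open>mprod\<close> adds new factors on the left, so the earlier block \<open>x\<close>
  ends up on the right.\<close>

lemma mprod_comb_seq: "mprod (comb_seq n x y) (n + m) = mprod y m ** mprod x n"
proof (induction m)
  case 0
  show ?case by (simp add: mprod_cong[of n "comb_seq n x y" x] comb_seq_less)
next
  case (Suc m)
  then show ?case using comb_seq_add[of n x y m] by (simp add: matrix_mul_assoc add.commute)
qed

text \<open>An i.i.d. sequence has the same law as \<open>n\<close> terms of one copy followed by an
  independent second copy.\<close>

lemma nn_integral_split:
  assumes [measurable]: "f \<in> borel_measurable seq_law"
  shows "(\<integral>\<^sup>+x. f x \<partial>seq_law) = (\<integral>\<^sup>+y. \<integral>\<^sup>+x. f (comb_seq n x y) \<partial>seq_law \<partial>seq_law)"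
proof -
  interpret sequence_space \<mu>
    by unfold_locales
  interpret P: prob_space seq_law by (rule prob_space_seq_law)
  interpret PP: pair_sigma_finite seq_law seq_law by unfold_locales
  have "(\<integral>\<^sup>+x. f x \<partial>seq_law) = (\<integral>\<^sup>+x. f x \<partial>distr (seq_law \<Otimes>\<^sub>M seq_law) seq_law (\<lambda>(x, y). comb_seq n x y))"
    by (simp only: PiM_comb_seq)
  also have "\<dots> = (\<integral>\<^sup>+p. f (case p of (x, y) \<Rightarrow> comb_seq n x y) \<partial>(seq_law \<Otimes>\<^sub>M seq_law))"
    by (intro nn_integral_distr measurable_comb_seq) measurable
  also have "\<dots> = (\<integral>\<^sup>+y. \<integral>\<^sup>+x. f (comb_seq n x y) \<partial>seq_law \<partial>seq_law)"
    by (subst PP.nn_integral_snd[symmetric]) (auto simp: case_prod_beta)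
  finally show ?thesis .
qed

text \<open>The argument \<open>c\<close> holds the product along the path already travelled;
  \<open>c = mat 1\<close> gives the moments occurring in \<open>kappa\<close>.\<close>

definition moment :: "real \<Rightarrow> nat \<Rightarrow> 'd rmat \<Rightarrow> ennreal" where
  "moment s n c = (\<integral>\<^sup>+x. ennreal (opnorm (c ** mprod x n) powr s) \<partial>seq_law)"

lemma moment_0: "moment s 0 c = ennreal (opnorm c powr s)"
  using prob_space.emeasure_space_1[OF prob_space_seq_law] by (simp add: moment_def)

lemma moment_measurable [measurable]: "moment s n \<in> borel_measurable borel"
proof -
  interpret P: prob_space seq_law by (rule prob_space_seq_law)
  show ?thesis unfolding moment_def by measurable
qed

text \<open>Splitting off the last factor of the sequence, which is the leftmost in the product,
  places a fresh matrix next to \<open>c\<close>.\<close>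

lemma moment_Suc: "moment s (Suc n) c = (\<integral>\<^sup>+a. moment s n (c ** a) \<partial>\<mu>)"
proof -
  have eq: "c ** mprod (comb_seq n x y) (Suc n) = (c ** y 0) ** mprod x n" for x y
    using mprod_comb_seq[of n x y 1] by (simp add: matrix_mul_assoc)
  have "moment s (Suc n) c = (\<integral>\<^sup>+y. moment s n (c ** y 0) \<partial>seq_law)"
    unfolding moment_def by (subst nn_integral_split[of _ n]) (simp_all only: eq, measurable)
  also have "\<dots> = (\<integral>\<^sup>+a. moment s n (c ** a) \<partial>distr seq_law \<mu> (\<lambda>y. y 0))"
    by (subst nn_integral_distr) auto
  also have "distr seq_law \<mu> (\<lambda>y. y 0) = \<mu>"
    by (rule distr_PiM_component) (auto intro: prob_space_axioms)
  finally show ?thesis .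
qed

lemma moment_add_le:
  assumes "0 \<le> s" shows "moment s (n + m) (mat 1) \<le> moment s n (mat 1) * moment s m (mat 1)"
proof -
  have "moment s (n + m) (mat 1)
      = (\<integral>\<^sup>+y. \<integral>\<^sup>+x. ennreal (opnorm (mprod y m ** mprod x n) powr s) \<partial>seq_law \<partial>seq_law)"
    unfolding moment_def by (subst nn_integral_split[of _ n]) (simp_all add: mprod_comb_seq)
  also have "\<dots> \<le> (\<integral>\<^sup>+y. \<integral>\<^sup>+x. ennreal (opnorm (mprod y m) powr s) * ennreal (opnorm (mprod x n) powr s) \<partial>seq_law \<partial>seq_law)"
    using assms opnorm_mult_le
    by (intro nn_integral_mono) (auto simp: ennreal_mult[symmetric] powr_mult[symmetric] opnorm_nonneg
        intro!: ennreal_leI powr_mono2)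
  also have "\<dots> = moment s m (mat 1) * moment s n (mat 1)"
    by (simp add: nn_integral_cmult nn_integral_multc moment_def)
  finally show ?thesis by (simp add: mult.commute)
qed

lemma kappa_eq: "kappa \<mu> s = lim (\<lambda>n. enn2real (moment s n (mat 1)) powr (1 / real n))"
  by (simp add: kappa_def moment_def)

text \<open>Since \<open>kappa\<close> is a \<open>lim\<close> of \<open>enn2real\<close> values, convergence (Fekete) and finiteness of the
  moments have to be established before a bound on \<open>kappa\<close> says anything.\<close>

lemma kappa_less_imp_moment_less:
  assumes s: "s \<in> I_mu \<mu>" and E: "0 < E" and less: "E * kappa \<mu> s < 1"
  shows "\<exists>n. ennreal E ^ n * moment s n (mat 1) < 1"
proof (rule ccontr)
  assume "\<not> ?thesis"
  then have ge: "1 \<le> ennreal E ^ n * moment s n (mat 1)" for n by (auto simp: not_less)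
  have s0: "0 \<le> s" using s by (simp add: I_mu_def)
  have m1: "moment s 1 (mat 1) < \<infinity>"
    using s by (simp add: I_mu_def moment_Suc moment_0)
  have fin: "moment s n (mat 1) < \<infinity>" for n
  proof (induction n)
    case (Suc n)
    have "moment s (Suc n) (mat 1) \<le> moment s n (mat 1) * moment s 1 (mat 1)"
      using moment_add_le[OF s0, of n 1] by simp
    also have "\<dots> < \<infinity>" using Suc m1 by (simp add: ennreal_mult_less_top)
    finally show ?case .
  qed (simp add: moment_0)
  define x where "x n = enn2real (moment s n (mat 1))" for n
  have mx: "moment s n (mat 1) = ennreal (x n)" for n using fin[of n] by (simp add: x_def)
  have x0: "0 \<le> x n" for n by (simp add: x_def)
  have sub: "x (m + n) \<le> x m * x n" for m n
    using moment_add_le[OF s0, of m n] x0 by (simp add: mx ennreal_mult[symmetric])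
  have ge': "1 \<le> E ^ n * x n" for n
    using ge[of n] E x0[of n] by (simp add: mx ennreal_power ennreal_mult[symmetric] flip: ennreal_1)
  have xpos: "0 < x n" for n using ge'[of n] x0[of n] by (cases "x n = 0") auto
  \<comment> \<open>Under the contrary assumption these logarithms are nonnegative, and they are
    subadditive. Their Fekete limit \<open>L \<ge> 0\<close> gives
    \<open>E * kappa \<mu> s = exp L \<ge> 1\<close>.\<close>
  define u where "u n = ln (E ^ n * x n)" for n
  have "u (m + n) \<le> u m + u n" for m n
  proof -
    have "u (m + n) \<le> ln ((E ^ m * x m) * (E ^ n * x n))"
      unfolding u_def using sub[of m n] E xpos by (subst ln_le_cancel_iff) (auto simp: power_add mult_ac)
    also have "\<dots> = u m + u n" unfolding u_def using E xpos by (intro ln_mult_pos) auto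
    finally show ?thesis .
  qed
  moreover have "0 \<le> u n" for n unfolding u_def using ge' by simp
  ultimately obtain L where L: "0 \<le> L" "(\<lambda>n. u n / n) \<longlonglongrightarrow> L" using fekete_nonneg by blast
  have "x n powr (1 / n) = exp (u n / n) / E" if "1 \<le> n" for n :: nat
  proof -
    have "u n / n = ln E + ln (x n) / n"
      unfolding u_def using that E xpos[of n] by (simp add: ln_mult ln_realpow field_simps)
    then show ?thesis using E xpos[of n] by (simp add: powr_def exp_add)
  qed
  then have "\<forall>\<^sub>F n in sequentially. exp (u n / n) / E = x n powr (1 / n)"
    by (auto simp: eventually_sequentially intro!: exI[of _ 1])
  moreover have "(\<lambda>n. exp (u n / n) / E) \<longlonglongrightarrow> exp L / E"
    using L E by (intro tendsto_intros) auto
  ultimately have "(\<lambda>n. x n powr (1 / n)) \<longlonglongrightarrow> exp L / E"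
    by (rule Lim_transform_eventually[rotated])
  then have "kappa \<mu> s = exp L / E" unfolding kappa_eq x_def by (rule limI)
  then show False using less E L by simp
qed

end

section \<open>The many-to-one formula\<close>

locale matrix_branching = prob_space M for M :: "'w measure" +
  fixes N :: "'w \<Rightarrow> nat" and A :: "'w \<Rightarrow> nat \<Rightarrow> 'd::finite rmat"
  assumes N_meas [measurable]: "N \<in> measurable M (count_space UNIV)"
    and A_meas [measurable]: "\<And>i. (\<lambda>w. A w i) \<in> borel_measurable M"
    and N_int: "integrable M (\<lambda>w. real (N w))"
    and EN_gt_1: "1 < (\<integral>w. real (N w) \<partial>M)"
begin

abbreviation EN :: real where "EN \<equiv> \<integral>w. real (N w) \<partial>M"

lemma nn_integral_N: "(\<integral>\<^sup>+w. of_nat (N w) \<partial>M) = ennreal EN"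
  by (subst nn_integral_eq_integral[symmetric, OF N_int]) (auto simp: ennreal_of_nat_eq_real_of_nat)

lemma measurable_sum_N [measurable]:
  fixes f :: "nat \<Rightarrow> 'w \<Rightarrow> ennreal"
  assumes [measurable]: "\<And>i. f i \<in> borel_measurable M"
  shows "(\<lambda>w. \<Sum>i<N w. f i w) \<in> borel_measurable M"
  by (rule measurable_compose_countable[OF _ N_meas]) measurable

text \<open>A second construction of \<open>mu_meas\<close>: choose a pair of outcome and index with
  density proportional to \<open>i < N w\<close> and read off the matrix. It is a measure by
  construction, whereas \<open>measure_of\<close> has the intended values only once countable
  additivity is known.\<close>

definition offspring_measure :: "'d rmat measure" where
  "offspring_measure = distr (density (M \<Otimes>\<^sub>M count_space UNIV)
     (\<lambda>(w, i). (if i < N w then 1 else 0) * inverse (ennreal EN))) borel (\<lambda>(w, i). A w i)"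

lemma nn_integral_offspring_measure:
  fixes f :: "'d rmat \<Rightarrow> ennreal"
  assumes [measurable]: "f \<in> borel_measurable borel"
  shows "(\<integral>\<^sup>+a. f a \<partial>offspring_measure) = (\<integral>\<^sup>+w. (\<Sum>i<N w. f (A w i)) \<partial>M) / ennreal EN"
proof -
  interpret C: sigma_finite_measure "count_space (UNIV :: nat set)"
    by (rule sigma_finite_measure_count_space)
  have [measurable]: "Measurable.pred (M \<Otimes>\<^sub>M count_space UNIV) (\<lambda>p. snd p < N (fst p))"
    by (rule measurable_compose_countable[where f = "\<lambda>i p. i < N (fst p)" and g = snd]) measurable
  have mA [measurable]: "(\<lambda>p. A (fst p) (snd p)) \<in> borel_measurable (M \<Otimes>\<^sub>M count_space UNIV)"
    by (rule measurable_compose_countable[where f = "\<lambda>i p. A (fst p) i" and g = snd]) measurable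
  have "(\<integral>\<^sup>+a. f a \<partial>offspring_measure)
      = (\<integral>\<^sup>+p. (if snd p < N (fst p) then 1 else 0) * inverse (ennreal EN) * f (A (fst p) (snd p)) \<partial>(M \<Otimes>\<^sub>M count_space UNIV))"
    unfolding offspring_measure_def case_prod_beta
    by (subst nn_integral_distr, measurable, subst nn_integral_density) auto
  also have "\<dots> = (\<integral>\<^sup>+w. \<integral>\<^sup>+i. (if i < N w then 1 else 0) * inverse (ennreal EN) * f (A w i) \<partial>count_space UNIV \<partial>M)"
    by (subst C.nn_integral_fst[symmetric]) auto
  also have "\<dots> = (\<integral>\<^sup>+w. (\<Sum>i<N w. f (A w i)) * inverse (ennreal EN) \<partial>M)"
  proof (intro nn_integral_cong)
    fix w
    have "(\<integral>\<^sup>+i. (if i < N w then 1 else 0) * inverse (ennreal EN) * f (A w i) \<partial>count_space UNIV)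
        = (\<Sum>i<N w. (if i < N w then 1 else 0) * inverse (ennreal EN) * f (A w i))"
      by (intro nn_integral_count_space') auto
    then show "(\<integral>\<^sup>+i. (if i < N w then 1 else 0) * inverse (ennreal EN) * f (A w i) \<partial>count_space UNIV)
        = (\<Sum>i<N w. f (A w i)) * inverse (ennreal EN)"
      by (simp add: sum_distrib_left mult_ac)
  qed
  also have "\<dots> = (\<integral>\<^sup>+w. (\<Sum>i<N w. f (A w i)) \<partial>M) / ennreal EN"
    by (subst nn_integral_multc) (auto simp: divide_ennreal_def)
  finally show ?thesis .
qed

lemma mu_meas_eq: "mu_meas M N A = offspring_measure"
proof -
  have "emeasure offspring_measure B = (\<integral>\<^sup>+ w. of_nat (card {i. i < N w \<and> A w i \<in> B}) \<partial>M) / (\<integral>\<^sup>+ w. of_nat (N w) \<partial>M)"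
    if B: "B \<in> sets borel" for B
  proof -
    have "emeasure offspring_measure B = (\<integral>\<^sup>+a. indicator B a \<partial>offspring_measure)"
      using B by (intro nn_integral_indicator[symmetric]) (simp add: offspring_measure_def)
    also have "\<dots> = (\<integral>\<^sup>+w. (\<Sum>i<N w. indicator B (A w i)) \<partial>M) / ennreal EN"
      using B by (intro nn_integral_offspring_measure) simp
    also have "(\<lambda>w. \<Sum>i<N w. indicator B (A w i) :: ennreal) = (\<lambda>w. of_nat (card {i. i < N w \<and> A w i \<in> B}))"
    proof
      fix w
      have "{..<N w} \<inter> {i. A w i \<in> B} = {i. i < N w \<and> A w i \<in> B}" by auto
      then show "(\<Sum>i<N w. indicator B (A w i) :: ennreal) = of_nat (card {i. i < N w \<and> A w i \<in> B})"
        by (simp add: indicator_def sum.If_cases)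
    qed
    finally show ?thesis by (simp add: nn_integral_N)
  qed
  then have "mu_meas M N A = measure_of UNIV (sets borel) (emeasure offspring_measure)"
    unfolding mu_meas_def by (intro measure_of_eq) (auto simp: sets.sigma_sets_eq[of borel, simplified])
  also have "\<dots> = offspring_measure"
    using measure_of_of_measure[of offspring_measure] by (simp add: offspring_measure_def)
  finally show ?thesis .
qed

sublocale mu: matrix_law "mu_meas M N A"
proof (intro matrix_law.intro prob_spaceI matrix_law_axioms.intro)
  show sets: "sets (mu_meas M N A) = sets borel" by (simp add: mu_meas_eq offspring_measure_def)
  have "emeasure offspring_measure (space offspring_measure) = (\<integral>\<^sup>+a. 1 \<partial>offspring_measure)" by simp
  also have "\<dots> = (\<integral>\<^sup>+w. (\<Sum>i<N w. 1) \<partial>M) / ennreal EN" by (intro nn_integral_offspring_measure) simp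
  also have "\<dots> = 1" using EN_gt_1 nn_integral_N by (simp add: ennreal_divide_self)
  finally show "emeasure (mu_meas M N A) (space (mu_meas M N A)) = 1" by (simp add: mu_meas_eq)
qed

text \<open>Expected sum, over the words of generation \<open>n\<close> of the branching process, of
  \<open>opnorm (c ** product along the word) powr s\<close>; \<open>branching_moment_Suc\<close> is
  its decomposition at the first generation.\<close>

definition branching_moment :: "real \<Rightarrow> nat \<Rightarrow> 'd rmat \<Rightarrow> ennreal" where
  "branching_moment s n c = ennreal EN ^ n * mu.moment s n c"

lemma branching_moment_0: "branching_moment s 0 c = ennreal (opnorm c powr s)"
  by (simp add: branching_moment_def mu.moment_0)

lemma branching_moment_measurable [measurable]: "branching_moment s n \<in> borel_measurable borel"
  unfolding branching_moment_def by measurable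

lemma branching_moment_Suc:
  "branching_moment s (Suc n) c = (\<integral>\<^sup>+w. (\<Sum>i<N w. branching_moment s n (c ** A w i)) \<partial>M)"
proof -
  have "branching_moment s (Suc n) c = ennreal EN * (\<integral>\<^sup>+a. branching_moment s n (c ** a) \<partial>mu_meas M N A)"
    unfolding branching_moment_def mu.moment_Suc by (simp add: nn_integral_cmult mult.assoc)
  also have "\<dots> = ennreal EN * ((\<integral>\<^sup>+w. (\<Sum>i<N w. branching_moment s n (c ** A w i)) \<partial>M) / ennreal EN)"
    unfolding mu_meas_eq by (subst nn_integral_offspring_measure) auto
  also have "\<dots> = (\<integral>\<^sup>+w. (\<Sum>i<N w. branching_moment s n (c ** A w i)) \<partial>M)"
    using EN_gt_1 by (subst ennreal_times_divide, subst mult.commute, intro ennreal_mult_divide_eq) auto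
  finally show ?thesis .
qed

end

section \<open>The support of a solution\<close>

lemma closed_meas_supp: "closed (meas_supp \<mu>)"
  unfolding closed_def
proof (subst open_subopen, intro ballI)
  fix x assume "x \<in> - meas_supp \<mu>"
  then obtain T where "open T" "x \<in> T" "emeasure \<mu> T = 0"
    by (auto simp: meas_supp_def not_gr_zero)
  then show "\<exists>T. open T \<and> x \<in> T \<and> T \<subseteq> - meas_supp \<mu>"
    by (intro exI[of _ T]) (auto simp: meas_supp_def)
qed

text \<open>The complement of the support is the union of all open null sets; by second countability
  countably many of them suffice.\<close>

lemma AE_meas_supp:
  fixes \<mu> :: "'b::second_countable_topology measure"
  assumes sets: "sets \<mu> = sets borel"
  shows "AE x in \<mu>. x \<in> meas_supp \<mu>"
proof -
  let ?F = "{T. open T \<and> emeasure \<mu> T = 0}"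
  obtain F where F: "F \<subseteq> ?F" "countable F" "\<Union>F = \<Union>?F"
    using Lindelof[of ?F] by auto
  have "T \<in> null_sets \<mu>" if "T \<in> F" for T
    using that F(1) sets by (auto intro!: null_setsI)
  then have "\<Union>F \<in> null_sets \<mu>" using F(2) by (intro null_sets_UN'[of F id, simplified]) auto
  moreover have "- meas_supp \<mu> = \<Union>?F"
    by (auto simp: meas_supp_def not_gr_zero)
  ultimately show ?thesis using F(3) by (intro AE_I'[of "\<Union>F"]) auto
qed

lemma rv_supp_eq_meas_supp:
  assumes "X \<in> borel_measurable M" shows "rv_supp M X = meas_supp (distr M borel X)"
proof -
  have "emeasure (distr M borel X) T = emeasure M {w \<in> space M. X w \<in> T}" if "open T" for T
    using assms that by (subst emeasure_distr) (auto simp: vimage_def Int_def conj_commute)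
  then show ?thesis by (auto simp: rv_supp_def meas_supp_def)
qed

lemma ennreal_prod_nonzero:
  fixes f :: "'i \<Rightarrow> ennreal"
  assumes "finite J" "\<And>i. i \<in> J \<Longrightarrow> f i \<noteq> 0" shows "prod f J \<noteq> 0"
  using assms by (induction J rule: finite_induct) auto

text \<open>If \<open>f y\<close> were outside \<open>C\<close>, some open box around
  \<open>y\<close> restricting only finitely many coordinates would be mapped outside
  \<open>C\<close>. Its probability is a finite product of positive numbers, contradicting
  \<open>ae\<close>.\<close>

lemma AE_PiM_closed:
  fixes \<eta> :: "'b::topological_space measure" and f :: "(nat \<Rightarrow> 'b) \<Rightarrow> 'c::topological_space"
  assumes eta: "prob_space \<eta>" "sets \<eta> = sets borel"
    and f: "continuous_on UNIV f" and C: "closed C"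
    and ae: "AE z in PiM UNIV (\<lambda>_. \<eta>). f z \<in> C" and y: "\<And>i. y i \<in> meas_supp \<eta>"
  shows "f y \<in> C"
proof (rule ccontr)
  assume "f y \<notin> C"
  have "open (f -` (- C))" using f C by (intro open_vimage) auto
  then have "openin (product_topology (\<lambda>i. euclidean) UNIV) (f -` (- C))" by (simp add: open_fun_def)
  from product_topology_open_contains_basis[OF this, of y] \<open>f y \<notin> C\<close>
  obtain X where X: "y \<in> (\<Pi>\<^sub>E i\<in>UNIV. X i)" "\<And>i. open (X i)" "finite {i. X i \<noteq> UNIV}"
    "(\<Pi>\<^sub>E i\<in>UNIV. X i) \<subseteq> f -` (- C)" by auto
  let ?J = "{i. X i \<noteq> UNIV}"
  interpret E: prob_space \<eta> by fact
  interpret product_prob_space "\<lambda>_. \<eta>" "UNIV :: nat set" by unfold_locales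
  have "emeasure (PiM UNIV (\<lambda>_. \<eta>)) {z \<in> space (PiM UNIV (\<lambda>_. \<eta>)). \<forall>i\<in>?J. z i \<in> X i} = (\<Prod>i\<in>?J. emeasure \<eta> (X i))"
    using X eta by (intro emeasure_PiM_Collect) auto
  also have "\<dots> \<noteq> 0"
  proof -
    have "y i \<in> X i" for i using X(1) by auto
    then have "0 < emeasure \<eta> (X i)" for i using X(2) y[of i] by (simp add: meas_supp_def)
    then have "emeasure \<eta> (X i) \<noteq> 0" for i by (rule less_imp_neq[THEN not_sym])
    then show ?thesis by (intro ennreal_prod_nonzero X(3))
  qed
  finally have nz: "emeasure (PiM UNIV (\<lambda>_. \<eta>)) {z \<in> space (PiM UNIV (\<lambda>_. \<eta>)). \<forall>i\<in>?J. z i \<in> X i} \<noteq> 0" .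
  have "AE z in PiM UNIV (\<lambda>_. \<eta>). \<not> (\<forall>i\<in>?J. z i \<in> X i)"
    using ae
  proof eventually_elim
    case (elim z)
    show ?case
    proof
      assume "\<forall>i\<in>?J. z i \<in> X i"
      then have "z \<in> (\<Pi>\<^sub>E i\<in>UNIV. X i)" by (auto simp: PiE_iff)
      then show False using X(4) elim by auto
    qed
  qed
  from emeasure_eq_0_AE[OF this] nz show False by (rule notE[rotated])
qed

context prob_space begin

lemma AE_imp_ex: assumes "AE w in M. P w" shows "\<exists>w\<in>space M. P w"
proof (rule ccontr)
  assume "\<not> ?thesis"
  then have "AE w in M. False" using assms by (auto elim!: AE_mp)
  then show False by simp
qed

text \<open>First-moment method within an almost sure event. If \<open>f\<close> exceeded its
  integral almost surely, that integral would be finite and the difference would integrate to zero,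
  forcing equality.\<close>

lemma ex_le_nn_integral:
  fixes f :: "'a \<Rightarrow> ennreal"
  assumes [measurable]: "f \<in> borel_measurable M" and P: "AE w in M. P w"
  shows "\<exists>w. P w \<and> f w \<le> (\<integral>\<^sup>+w. f w \<partial>M)"
proof (rule ccontr)
  let ?K = "\<integral>\<^sup>+w. f w \<partial>M"
  assume "\<not> ?thesis"
  then have less: "AE w in M. ?K < f w" using P by (auto simp: not_le elim!: AE_mp)
  then obtain w where "?K < f w" using AE_imp_ex by blast
  then have fin: "?K \<noteq> \<infinity>" by auto
  have "(\<integral>\<^sup>+w. f w - ?K \<partial>M) = ?K - (\<integral>\<^sup>+w. ?K \<partial>M)"
    using less fin by (intro nn_integral_diff) (auto simp: emeasure_space_1)
  also have "\<dots> = 0" using fin by (simp add: emeasure_space_1)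
  finally have "AE w in M. f w - ?K = 0" by (subst (asm) nn_integral_0_iff_AE) auto
  with less have "AE w in M. False" by eventually_elim (auto simp: diff_eq_0_iff_ennreal)
  then show False by simp
qed

end

text \<open>\<open>path_prod\<close> is a left fold. Induction over trees needs the first letter
  split off, with the family shifted to the subtree below it.\<close>

lemma path_prod_Cons: "path_prod fam (i # u) = fam [] i ** path_prod (\<lambda>v. fam (i # v)) u"
proof -
  have gen: "foldl (\<lambda>P k. P ** f k) (a ** b) ks = a ** foldl (\<lambda>P k. P ** f k) b ks"
    for f :: "nat \<Rightarrow> 'a::finite rmat" and a b ks
    by (induction ks arbitrary: b) (simp_all add: matrix_mul_assoc[symmetric])
  have "[0..<length (i # u)] = 0 # map Suc [0..<length u]"
    by (simp add: upt_conv_Cons map_Suc_upt del: upt_Suc)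
  then show ?thesis
    using gen[of "\<lambda>k. fam (i # take k u) (u ! k)" "fam [] i" "mat 1" "[0..<length u]"]
    by (simp add: path_prod_def foldl_map)
qed

lemma path_prod_Nil [simp]: "path_prod fam [] = mat 1"
  by (simp add: path_prod_def)

text \<open>Padding \<open>u @ x\<close> with zeros gives an infinite sequence with both words as
  prefixes; uniqueness of the prefix in \<open>U\<close> equates their lengths.\<close>

lemma cover_set_prefix_free:
  assumes U: "cover_set U" and "u \<in> U" "u @ x \<in> U" shows "x = []"
proof -
  define s where "s k = (if k < length (u @ x) then (u @ x) ! k else 0)" for k
  have "map s [0..<length u] = u" by (rule nth_equalityI) (auto simp: s_def nth_append)
  moreover have "map s [0..<length (u @ x)] = u @ x" by (rule nth_equalityI) (auto simp: s_def)
  ultimately have "length u = length (u @ x)" using assms by (metis cover_set_def)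
  then show ?thesis by simp
qed

section \<open>The support under the fixed-point equation\<close>

locale smoothing_solution = matrix_branching M N A
  for M :: "'w measure" and N and A :: "'w \<Rightarrow> nat \<Rightarrow> 'd::finite rmat" +
  fixes Z :: "'w \<Rightarrow> real ^ 'd"
  assumes Z_meas [measurable]: "Z \<in> borel_measurable M"
    and N_ge_1: "AE w in M. 1 \<le> N w"
    and A_nonneg: "AE w in M. \<forall>i. nonneg_mat (A w i)"
    and A_nonzero: "AE w in M. \<forall>i. A w i \<noteq> 0 \<longleftrightarrow> i < N w"
    and supp_rows_cols: "\<And>a. a \<in> meas_supp (mu_meas M N A) \<Longrightarrow>
       (\<forall>i. \<exists>j. 0 < a $ i $ j) \<and> (\<forall>j. \<exists>i. 0 < a $ i $ j)"
    and Z_nonneg: "AE w in M. nonneg_vec (Z w)"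
    and Z_sol: "distr M borel Z =
          distr (distr M (count_space UNIV \<Otimes>\<^sub>M PiM UNIV (\<lambda>_::nat. borel)) (\<lambda>w. (N w, A w))
                 \<Otimes>\<^sub>M PiM UNIV (\<lambda>_::nat. distr M borel Z))
            borel (\<lambda>((n, a), z). \<Sum>i<n. a i *v z i)"
    and Z_nz: "measure M {w \<in> space M. Z w = 0} = 0"
begin

abbreviation \<eta> :: "(real^'d) measure" where "\<eta> \<equiv> distr M borel Z"
abbreviation NA_law :: "(nat \<times> (nat \<Rightarrow> 'd rmat)) measure" where
  "NA_law \<equiv> distr M (count_space UNIV \<Otimes>\<^sub>M PiM UNIV (\<lambda>_::nat. borel)) (\<lambda>w. (N w, A w))"
abbreviation eta_seq :: "(nat \<Rightarrow> real^'d) measure" where "eta_seq \<equiv> PiM UNIV (\<lambda>_::nat. \<eta>)"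
abbreviation S :: "(real^'d) set" where "S \<equiv> rv_supp M Z"

lemma prob_eta: "prob_space \<eta>" by (rule prob_space_distr) simp

lemma prob_eta_seq: "prob_space eta_seq" by (rule prob_space_PiM) (rule prob_eta)

lemma NA_measurable [measurable]: "(\<lambda>w. (N w, A w)) \<in> measurable M (count_space UNIV \<Otimes>\<^sub>M PiM UNIV (\<lambda>_::nat. borel))"
proof -
  have "A \<in> measurable M (PiM UNIV (\<lambda>_::nat. borel))"
    by (rule measurable_PiM_single') auto
  then show ?thesis by measurable
qed

lemma prob_NA: "prob_space NA_law" by (rule prob_space_distr) simp

lemma component_borel [measurable]: "(\<lambda>z. z i) \<in> borel_measurable eta_seq"
  using measurable_component_singleton[of i UNIV "\<lambda>_. \<eta>"] by (simp cong: measurable_cong_sets)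

lemma smoothing_map_measurable [measurable]:
  "(\<lambda>((n, a), z). \<Sum>i<n. a i *v z i) \<in> borel_measurable (NA_law \<Otimes>\<^sub>M eta_seq)"
proof -
  have [measurable]: "(\<lambda>p. fst p) \<in> measurable NA_law (count_space UNIV)"
    by (simp cong: measurable_cong_sets)
  have [measurable]: "(\<lambda>p. snd p i) \<in> borel_measurable NA_law" for i
  proof -
    have "(\<lambda>p. snd p i) \<in> borel_measurable (count_space UNIV \<Otimes>\<^sub>M PiM UNIV (\<lambda>_::nat. borel))"
      by measurable
    then show ?thesis by (simp cong: measurable_cong_sets)
  qed
  have "(\<lambda>p. \<Sum>i<fst (fst p). snd (fst p) i *v snd p i) \<in> borel_measurable (NA_law \<Otimes>\<^sub>M eta_seq)"
    by (rule measurable_compose_countable[where f = "\<lambda>n p. \<Sum>i<n. snd (fst p) i *v snd p i" and g = "\<lambda>p. fst (fst p)"])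
      measurable
  then show ?thesis by (simp add: case_prod_beta')
qed

lemma S_eq: "S = meas_supp \<eta>" by (rule rv_supp_eq_meas_supp) simp

lemma closed_S: "closed S" unfolding S_eq by (rule closed_meas_supp)

lemma AE_Z_in_S: "AE w in M. Z w \<in> S"
  using AE_meas_supp[of \<eta>] unfolding S_eq[symmetric] by (intro AE_distrD[of Z M borel]) auto

lemma nonneg_S: assumes "x \<in> S" shows "nonneg_vec x"
proof (rule ccontr)
  assume "\<not> nonneg_vec x"
  then obtain i where i: "x $ i < 0" by (auto simp: nonneg_vec_def not_le)
  have "open {x :: real^'d. x $ i < 0}" by (intro open_Collect_less continuous_intros)
  with assms i have "0 < emeasure M {w \<in> space M. Z w \<in> {x. x $ i < 0}}"
    by (auto simp: rv_supp_def)
  moreover have "AE w in M. \<not> Z w \<in> {x. x $ i < 0}"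
    using Z_nonneg by eventually_elim (auto simp: nonneg_vec_def not_less)
  ultimately show False using emeasure_eq_0_AE by fastforce
qed

lemma S_nonempty: "\<exists>x. x \<in> S"
  using AE_imp_ex[OF AE_Z_in_S] by blast

text \<open>By Fubini, almost every realisation satisfies the inclusion for almost every
  \<open>z\<close>. For a fixed realisation the sum is continuous in \<open>z\<close> and
  \<open>S\<close> is closed, so the inclusion extends to all \<open>z\<close> at once, without an
  exceptional set depending on \<open>z\<close>.\<close>

lemma smoothing_closed: "AE w in M. \<forall>z. (\<forall>i. z i \<in> S) \<longrightarrow> (\<Sum>i<N w. A w i *v z i) \<in> S"
proof -
  interpret E: prob_space eta_seq by (rule prob_eta_seq)
  interpret NA: prob_space NA_law by (rule prob_NA)
  interpret P: pair_sigma_finite NA_law eta_seq by unfold_locales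
  let ?F = "\<lambda>((n, a), z). \<Sum>i<n. a i *v (z i :: real^'d)"
  have "AE x in distr (NA_law \<Otimes>\<^sub>M eta_seq) borel ?F. x \<in> S"
    by (subst Z_sol[symmetric]) (simp add: S_eq AE_meas_supp)
  then have "AE p in NA_law \<Otimes>\<^sub>M eta_seq. ?F p \<in> S" by (rule AE_distrD[rotated]) simp
  from P.AE_pair[OF this] have "AE na in NA_law. AE z in eta_seq. ?F (na, z) \<in> S" .
  then have "AE w in M. AE z in eta_seq. ?F ((N w, A w), z) \<in> S" by (rule AE_distrD[rotated]) simp
  then show ?thesis
  proof eventually_elim
    case (elim w)
    have cont: "continuous_on UNIV (\<lambda>z. \<Sum>i<N w. A w i *v (z i :: real^'d))"
      by (intro continuous_on_sum continuous_matvec continuous_on_const continuous_on_product_coordinates)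
    have ae: "AE z in eta_seq. (\<Sum>i<N w. A w i *v z i) \<in> S" using elim by simp
    show ?case
    proof (intro allI impI)
      fix z :: "nat \<Rightarrow> real^'d" assume "\<forall>i. z i \<in> S"
      then show "(\<Sum>i<N w. A w i *v z i) \<in> S"
        by (intro AE_PiM_closed[OF prob_eta _ cont closed_S ae]) (simp_all add: S_eq)
    qed
  qed
qed

text \<open>The expected number of letters outside the support of \<open>mu_meas\<close> is
  \<open>EN\<close> times the mass of the complement, which is zero.\<close>

lemma A_allowable: "AE w in M. \<forall>i<N w. allowable (A w i)"
proof -
  let ?\<mu> = "mu_meas M N A"
  let ?B = "- meas_supp ?\<mu>"
  have [measurable]: "?B \<in> sets borel" using closed_meas_supp[of ?\<mu>] by auto
  have "AE a in ?\<mu>. a \<notin> ?B" using AE_meas_supp[of ?\<mu>] by simp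
  then have "(\<integral>\<^sup>+a. indicator ?B a \<partial>?\<mu>) = 0"
    by (subst nn_integral_0_iff_AE) (auto simp: indicator_def)
  then have "(\<integral>\<^sup>+w. (\<Sum>i<N w. indicator ?B (A w i)) \<partial>M) / ennreal EN = 0"
    unfolding mu_meas_eq by (subst (asm) nn_integral_offspring_measure) (auto simp: mu_meas_eq[symmetric])
  then have "(\<integral>\<^sup>+w. (\<Sum>i<N w. indicator ?B (A w i) :: ennreal) \<partial>M) = 0"
    by (simp add: ennreal_divide_eq_0_iff)
  then have "AE w in M. (\<Sum>i<N w. indicator ?B (A w i) :: ennreal) = 0"
    by (subst (asm) nn_integral_0_iff_AE) auto
  then show ?thesis using A_nonneg
  proof eventually_elim
    case (elim w)
    have "allowable (A w i)" if "i < N w" for i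
    proof -
      have "A w i \<in> meas_supp ?\<mu>" using elim(1) that by (auto simp: indicator_def split: if_splits)
      then show ?thesis using supp_rows_cols elim(2) by (auto simp: allowable_def)
    qed
    then show ?case by blast
  qed
qed

text \<open>Collects the almost sure properties, so that one realisation chosen by a first-moment
  argument has all of them.\<close>

definition good :: "'w \<Rightarrow> bool" where
  "good w \<longleftrightarrow> 1 \<le> N w \<and> (\<forall>i. A w i \<noteq> 0 \<longleftrightarrow> i < N w) \<and> (\<forall>i<N w. allowable (A w i)) \<and>
     (\<forall>z. (\<forall>i. z i \<in> S) \<longrightarrow> (\<Sum>i<N w. A w i *v z i) \<in> S)"

lemma AE_good: "AE w in M. good w"
  using N_ge_1 A_nonzero A_allowable smoothing_closed unfolding good_def by eventually_elim auto

text \<open>The first-moment method selects a good realisation whose summed moments do not exceed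
  their expectation; the induction hypothesis then applies to each child \<open>i\<close> with
  \<open>c ** A w i\<close> in place of \<open>c\<close>. Subadditivity of \<open>powr s\<close>
  recombines the children.\<close>

lemma descend_point:
  assumes x: "x \<in> S" and s: "0 < s" "s \<le> 1"
  shows "\<exists>y\<in>S. ennreal (l1 (c *v y) powr s) \<le> branching_moment s n c * ennreal (l1 x powr s)"
proof (induction n arbitrary: c)
  case 0
  have "l1 (c *v x) powr s \<le> (opnorm c * l1 x) powr s"
    using l1_matvec_le s by (intro powr_mono2) (auto simp: l1_nonneg)
  then show ?case
    using x by (intro bexI[of _ x]) (auto simp: branching_moment_0 powr_mult opnorm_nonneg l1_nonneg ennreal_mult[symmetric] intro!: ennreal_leI)
next
  case (Suc n)
  have "(\<lambda>w. \<Sum>i<N w. branching_moment s n (c ** A w i)) \<in> borel_measurable M" by measurable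
  from ex_le_nn_integral[OF this AE_good] obtain w where w: "good w"
    and le: "(\<Sum>i<N w. branching_moment s n (c ** A w i)) \<le> branching_moment s (Suc n) c"
    unfolding branching_moment_Suc by blast
  have "\<forall>i. \<exists>y. y \<in> S \<and> ennreal (l1 ((c ** A w i) *v y) powr s) \<le> branching_moment s n (c ** A w i) * ennreal (l1 x powr s)"
    using Suc by blast
  from choice[OF this] obtain y where y: "\<And>i. y i \<in> S"
    "\<And>i. ennreal (l1 ((c ** A w i) *v y i) powr s) \<le> branching_moment s n (c ** A w i) * ennreal (l1 x powr s)"
    by blast
  have "l1 (c *v (\<Sum>i<N w. A w i *v y i)) \<le> (\<Sum>i<N w. l1 ((c ** A w i) *v y i))"
    by (simp add: matvec_sum_right matrix_vector_mul_assoc l1_sum_le)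
  then have "l1 (c *v (\<Sum>i<N w. A w i *v y i)) powr s \<le> (\<Sum>i<N w. l1 ((c ** A w i) *v y i)) powr s"
    using s by (intro powr_mono2) (auto simp: l1_nonneg)
  also have "\<dots> \<le> (\<Sum>i<N w. l1 ((c ** A w i) *v y i) powr s)"
    using s by (intro powr_sum_le) (auto simp: l1_nonneg)
  finally have "ennreal (l1 (c *v (\<Sum>i<N w. A w i *v y i)) powr s) \<le> (\<Sum>i<N w. ennreal (l1 ((c ** A w i) *v y i) powr s))"
    by (subst sum_ennreal) (auto intro: ennreal_leI)
  also have "\<dots> \<le> (\<Sum>i<N w. branching_moment s n (c ** A w i) * ennreal (l1 x powr s))"
    by (intro sum_mono y)
  also have "\<dots> \<le> branching_moment s (Suc n) c * ennreal (l1 x powr s)"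
    unfolding sum_distrib_right[symmetric] by (intro mult_right_mono le) simp
  finally show ?case using w y by (intro bexI[of _ "\<Sum>i<N w. A w i *v y i"]) (auto simp: good_def)
qed

text \<open>A point of \<open>S\<close> of minimal norm must be \<open>0\<close>, since
  \<open>descend_point\<close> produces a strictly smaller point from any nonzero one.\<close>

lemma zero_in_S:
  assumes s: "0 < s" "s \<le> 1" and small: "branching_moment s n (mat 1) < 1"
  shows "0 \<in> S"
proof -
  obtain x0 where x0: "x0 \<in> S" using S_nonempty by blast
  \<comment> \<open>Truncation at the norm of one point of \<open>S\<close> gives a compact set
    whose minimum is the minimum over all of \<open>S\<close>.\<close>
  let ?K = "S \<inter> {x. l1 x \<le> l1 x0}"
  have "closed {x :: real^'d. l1 x \<le> l1 x0}"
    by (intro closed_Collect_le continuous_on_l1 continuous_on_const)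
  then have "closed ?K" using closed_S by (rule closed_Int[rotated])
  moreover have "bounded ?K"
    by (rule boundedI[of _ "l1 x0"]) (auto intro: order.trans[OF norm_le_l1])
  ultimately have "compact ?K" by (simp add: compact_eq_bounded_closed)
  then obtain x where x: "x \<in> ?K" "\<And>y. y \<in> ?K \<Longrightarrow> l1 x \<le> l1 y"
    using continuous_attains_inf[of ?K l1] continuous_on_l1 x0 by blast
  have xmin: "l1 x \<le> l1 y" if "y \<in> S" for y
    using x that by (cases "l1 y \<le> l1 x0") auto
  obtain y where y: "y \<in> S" "ennreal (l1 y powr s) \<le> branching_moment s n (mat 1) * ennreal (l1 x powr s)"
    using descend_point[of x s "mat 1" n] x s by auto
  have "l1 x = 0"
  proof (rule ccontr)
    assume "l1 x \<noteq> 0"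
    then have pos: "0 < l1 x powr s" using l1_nonneg[of x] by simp
    have "ennreal (l1 x powr s) \<le> ennreal (l1 y powr s)"
      using xmin[OF y(1)] s by (intro ennreal_leI powr_mono2) (auto simp: l1_nonneg)
    also have "\<dots> \<le> branching_moment s n (mat 1) * ennreal (l1 x powr s)" by (rule y(2))
    also have "\<dots> < 1 * ennreal (l1 x powr s)"
      using small pos by (intro ennreal_mult_strict_right_mono) auto
    finally show False by simp
  qed
  then have "x = 0" by (simp add: l1_eq_0_iff)
  then show ?thesis using x(1) by blast
qed

text \<open>The same descent along a single path: always follow the first child, which exists
  because \<open>1 \<le> N w\<close>, and feed \<open>0\<close> to its siblings. With
  \<open>c = mat 1\<close> and a branching moment below 1 the product \<open>d\<close> is a strict
  contraction.\<close>

lemma descend_matrix: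
  assumes zero: "0 \<in> S"
  shows "\<exists>d. allowable d \<and> (\<forall>z\<in>S. d *v z \<in> S) \<and> ennreal (opnorm (c ** d) powr s) \<le> branching_moment s n c"
proof (induction n arbitrary: c)
  case 0
  show ?case by (intro exI[of _ "mat 1"]) (simp add: branching_moment_0 allowable_mat_1)
next
  case (Suc n)
  have "(\<lambda>w. \<Sum>i<N w. branching_moment s n (c ** A w i)) \<in> borel_measurable M" by measurable
  from ex_le_nn_integral[OF this AE_good] obtain w where w: "good w"
    and le: "(\<Sum>i<N w. branching_moment s n (c ** A w i)) \<le> branching_moment s (Suc n) c"
    unfolding branching_moment_Suc by blast
  have N: "0 < N w" using w by (simp add: good_def)
  obtain d where d: "allowable d" "\<And>z. z \<in> S \<Longrightarrow> d *v z \<in> S"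
    "ennreal (opnorm (c ** A w 0 ** d) powr s) \<le> branching_moment s n (c ** A w 0)"
    using Suc[of "c ** A w 0"] by blast
  have "A w 0 *v z \<in> S" if z: "z \<in> S" for z
  proof -
    have "(\<Sum>i<N w. A w i *v (if i = 0 then z else 0)) \<in> S"
      using w z zero unfolding good_def by (simp split: if_split)
    also have "(\<Sum>i<N w. A w i *v (if i = 0 then z else 0)) = (\<Sum>i\<in>{0}. A w i *v z)"
      using N by (intro sum.mono_neutral_cong_right) auto
    finally show ?thesis by simp
  qed
  then have "\<forall>z\<in>S. (A w 0 ** d) *v z \<in> S" using d(2) by (simp add: matrix_vector_mul_assoc[symmetric])
  moreover have "allowable (A w 0 ** d)"
    using w N d(1) by (intro allowable_mult) (auto simp: good_def)
  moreover have "branching_moment s n (c ** A w 0) \<le> (\<Sum>i<N w. branching_moment s n (c ** A w i))"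
    using N by (intro member_le_sum) auto
  then have "ennreal (opnorm (c ** (A w 0 ** d)) powr s) \<le> branching_moment s (Suc n) c"
    using d(3) le by (simp add: matrix_mul_assoc)
  ultimately show ?case by blast
qed

definition image_moment :: "real \<Rightarrow> 'd rmat \<Rightarrow> ennreal" where
  "image_moment s c = (\<integral>\<^sup>+z. ennreal (l1 (c *v z) powr s) \<partial>\<eta>)"

lemma image_moment_measurable [measurable]: "image_moment s \<in> borel_measurable borel"
proof -
  interpret E: prob_space \<eta> by (rule prob_eta)
  show ?thesis unfolding image_moment_def by measurable
qed

text \<open>Replace \<open>Z\<close> by the right-hand side of its equation, apply subadditivity of
  \<open>powr s\<close>, and integrate the independent copies first.\<close>

lemma image_moment_recursion:
  assumes s: "0 < s" "s \<le> 1"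
  shows "image_moment s c \<le> (\<integral>\<^sup>+w. (\<Sum>i<N w. image_moment s (c ** A w i)) \<partial>M)"
proof -
  interpret E: prob_space eta_seq by (rule prob_eta_seq)
  let ?F = "\<lambda>((n, a), z). \<Sum>i<n. a i *v (z i :: real^'d)"
  let ?f = "\<lambda>x. ennreal (l1 (c *v x) powr s)"
  have fm [measurable]: "?f \<in> borel_measurable borel" by measurable
  have "image_moment s c = (\<integral>\<^sup>+x. ?f x \<partial>distr (NA_law \<Otimes>\<^sub>M eta_seq) borel ?F)"
    unfolding image_moment_def by (subst Z_sol) simp
  also have "\<dots> = (\<integral>\<^sup>+p. ?f (?F p) \<partial>(NA_law \<Otimes>\<^sub>M eta_seq))"
    by (intro nn_integral_distr smoothing_map_measurable) simp
  also have "\<dots> = (\<integral>\<^sup>+na. \<integral>\<^sup>+z. ?f (?F (na, z)) \<partial>eta_seq \<partial>NA_law)"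
    by (intro E.nn_integral_fst[symmetric] measurable_compose[OF smoothing_map_measurable fm])
  also have "\<dots> = (\<integral>\<^sup>+w. \<integral>\<^sup>+z. ?f (?F ((N w, A w), z)) \<partial>eta_seq \<partial>M)"
    by (intro nn_integral_distr NA_measurable E.borel_measurable_nn_integral_fst
        measurable_compose[OF smoothing_map_measurable fm])
  also have "\<dots> \<le> (\<integral>\<^sup>+w. (\<Sum>i<N w. image_moment s (c ** A w i)) \<partial>M)"
  proof (intro nn_integral_mono)
    fix w
    have "?f (?F ((N w, A w), z)) \<le> (\<Sum>i<N w. ennreal (l1 ((c ** A w i) *v z i) powr s))" for z
    proof -
      have "l1 (c *v (\<Sum>i<N w. A w i *v z i)) \<le> (\<Sum>i<N w. l1 ((c ** A w i) *v z i))"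
        by (simp add: matvec_sum_right matrix_vector_mul_assoc l1_sum_le)
      then have "l1 (c *v (\<Sum>i<N w. A w i *v z i)) powr s \<le> (\<Sum>i<N w. l1 ((c ** A w i) *v z i)) powr s"
        using s by (intro powr_mono2) (auto simp: l1_nonneg)
      also have "\<dots> \<le> (\<Sum>i<N w. l1 ((c ** A w i) *v z i) powr s)"
        using s by (intro powr_sum_le) (auto simp: l1_nonneg)
      finally show ?thesis by (subst sum_ennreal) (auto intro: ennreal_leI)
    qed
    then have "(\<integral>\<^sup>+z. ?f (?F ((N w, A w), z)) \<partial>eta_seq)
        \<le> (\<integral>\<^sup>+z. (\<Sum>i<N w. ennreal (l1 ((c ** A w i) *v z i) powr s)) \<partial>eta_seq)"
      by (rule nn_integral_mono)
    also have "\<dots> = (\<Sum>i<N w. \<integral>\<^sup>+z. ennreal (l1 ((c ** A w i) *v z i) powr s) \<partial>eta_seq)"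
      by (intro nn_integral_sum) measurable
    also have "\<dots> = (\<Sum>i<N w. image_moment s (c ** A w i))"
    proof (intro sum.cong refl)
      fix i
      have "image_moment s (c ** A w i) = (\<integral>\<^sup>+x. ennreal (l1 ((c ** A w i) *v x) powr s) \<partial>distr eta_seq \<eta> (\<lambda>z. z i))"
        unfolding image_moment_def by (subst distr_PiM_component[of UNIV "\<lambda>_. \<eta>" i]) (auto intro: prob_eta)
      also have "\<dots> = (\<integral>\<^sup>+z. ennreal (l1 ((c ** A w i) *v z i) powr s) \<partial>eta_seq)"
        by (intro nn_integral_distr) auto
      finally show "(\<integral>\<^sup>+z. ennreal (l1 ((c ** A w i) *v z i) powr s) \<partial>eta_seq) = image_moment s (c ** A w i)" ..
    qed
    finally show "(\<integral>\<^sup>+z. ?f (?F ((N w, A w), z)) \<partial>eta_seq) \<le> (\<Sum>i<N w. image_moment s (c ** A w i))" .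
  qed
  finally show ?thesis .
qed

lemma image_moment_le:
  assumes s: "0 < s" "s \<le> 1"
  shows "image_moment s c \<le> branching_moment s n c * image_moment s (mat 1)"
proof (induction n arbitrary: c)
  case 0
  have "image_moment s c \<le> (\<integral>\<^sup>+z. ennreal (opnorm c powr s) * ennreal (l1 z powr s) \<partial>\<eta>)"
    unfolding image_moment_def
  proof (intro nn_integral_mono)
    fix x :: "real^'d"
    have "l1 (c *v x) powr s \<le> (opnorm c * l1 x) powr s"
      using l1_matvec_le s by (intro powr_mono2) (auto simp: l1_nonneg)
    then show "ennreal (l1 (c *v x) powr s) \<le> ennreal (opnorm c powr s) * ennreal (l1 x powr s)"
      by (auto simp: powr_mult opnorm_nonneg l1_nonneg ennreal_mult[symmetric] intro!: ennreal_leI)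
  qed
  also have "\<dots> = branching_moment s 0 c * image_moment s (mat 1)"
    by (subst nn_integral_cmult) (auto simp: branching_moment_0 image_moment_def)
  finally show ?case .
next
  case (Suc n)
  have "image_moment s c \<le> (\<integral>\<^sup>+w. (\<Sum>i<N w. image_moment s (c ** A w i)) \<partial>M)"
    by (rule image_moment_recursion[OF s])
  also have "\<dots> \<le> (\<integral>\<^sup>+w. (\<Sum>i<N w. branching_moment s n (c ** A w i)) * image_moment s (mat 1) \<partial>M)"
    unfolding sum_distrib_right by (intro nn_integral_mono sum_mono Suc)
  also have "\<dots> = branching_moment s (Suc n) c * image_moment s (mat 1)"
    by (subst nn_integral_multc) (auto simp: branching_moment_Suc)
  finally show ?case .
qed

text \<open>On a bounded support the moment of order \<open>s\<close> would be finite and at most a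
  multiple below 1 of itself, hence zero; then \<open>Z = 0\<close> almost surely, against
  \<open>Z_nz\<close>.\<close>

lemma unbounded_S:
  assumes s: "0 < s" "s \<le> 1" and small: "branching_moment s n (mat 1) < 1"
  shows "\<exists>x\<in>S. K \<le> l1 x"
proof (rule ccontr)
  assume "\<not> ?thesis"
  then have bd: "l1 x \<le> K" if "x \<in> S" for x using that by force
  let ?H = "image_moment s (mat 1)"
  have H: "?H = (\<integral>\<^sup>+w. ennreal (l1 (Z w) powr s) \<partial>M)"
    unfolding image_moment_def by (subst nn_integral_distr) auto
  have "?H \<le> (\<integral>\<^sup>+w. ennreal (K powr s) \<partial>M)"
    unfolding H
  proof (intro nn_integral_mono_AE, use AE_Z_in_S in eventually_elim)
    case (elim w)
    show ?case using bd[OF elim] s by (intro ennreal_leI powr_mono2) (auto simp: l1_nonneg)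
  qed
  then have fin: "?H < \<infinity>" by (auto simp: emeasure_space_1 intro: le_less_trans)
  have "?H = 0"
  proof (rule ccontr)
    assume "?H \<noteq> 0"
    have "?H \<le> branching_moment s n (mat 1) * ?H" by (rule image_moment_le[OF s])
    also have "\<dots> < 1 * ?H"
      using small fin \<open>?H \<noteq> 0\<close> by (intro ennreal_mult_strict_right_mono) (auto simp: zero_less_iff_neq_zero)
    finally show False by simp
  qed
  then have "AE w in M. ennreal (l1 (Z w) powr s) = 0"
    unfolding H by (subst (asm) nn_integral_0_iff_AE) auto
  then have "AE w in M. Z w = 0"
    by eventually_elim (auto simp: ennreal_eq_0_iff l1_eq_0_iff)
  then have "measure M {w \<in> space M. Z w = 0} = 1"
    by (intro prob_Collect_eq_1[THEN iffD2]) auto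
  then show False using Z_nz by simp
qed

text \<open>Since \<open>EN > 1\<close>, some good realisation has two children; all further
  children receive \<open>0\<close>.\<close>

lemma ex_branch:
  assumes zero: "0 \<in> S"
  obtains b1 b2 where "allowable b1" "allowable b2" "\<And>x y. x \<in> S \<Longrightarrow> y \<in> S \<Longrightarrow> b1 *v x + b2 *v y \<in> S"
proof -
  have "\<exists>w. good w \<and> 2 \<le> N w"
  proof (rule ccontr)
    assume none: "\<not> ?thesis"
    have "AE w in M. N w \<le> 1"
      using AE_good by eventually_elim (use none not_less_eq_eq in \<open>force simp: numeral_2_eq_2\<close>)
    then have "EN \<le> (\<integral>w. 1 \<partial>M)" by (intro integral_mono_AE N_int) auto
    then show False using EN_gt_1 by (simp add: prob_space)
  qed
  then obtain w where w: "good w" "2 \<le> N w" by blast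
  have "A w 0 *v x + A w 1 *v y \<in> S" if "x \<in> S" "y \<in> S" for x y
  proof -
    let ?z = "\<lambda>i::nat. if i = 0 then x else if i = 1 then y else 0"
    have "(\<Sum>i<N w. A w i *v ?z i) \<in> S"
      using w that zero unfolding good_def by (simp split: if_split)
    also have "(\<Sum>i<N w. A w i *v ?z i) = (\<Sum>i\<in>{0, 1}. A w i *v ?z i)"
      using w(2) by (intro sum.mono_neutral_right) auto
    finally show ?thesis by simp
  qed
  moreover have "allowable (A w 0)" "allowable (A w 1)" using w by (auto simp: good_def)
  ultimately show ?thesis using that by blast
qed

text \<open>With the \<open>y i\<close> fixed, the sequences of matrices violating the conclusion
  form an open set. A good realisation avoids it: points outside \<open>I\<close> are set to
  \<open>0\<close> and matrices from index \<open>N w\<close> on vanish, so the sum over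
  \<open>I\<close> equals the sum over all children.\<close>

lemma supp_sum_in_S:
  assumes zero: "0 \<in> S" and a: "a \<in> rv_supp M A" and I: "finite I" and y: "\<And>i. i \<in> I \<Longrightarrow> y i \<in> S"
  shows "(\<Sum>i\<in>I. a i *v y i) \<in> S"
proof (rule ccontr)
  assume "(\<Sum>i\<in>I. a i *v y i) \<notin> S"
  let ?f = "\<lambda>b :: nat \<Rightarrow> 'd rmat. \<Sum>i\<in>I. b i *v y i"
  let ?T = "?f -` (- S)"
  have "continuous_on UNIV ?f"
    by (intro continuous_on_sum continuous_matvec continuous_on_const continuous_on_product_coordinates)
  then have "open ?T" using closed_S by (intro open_vimage) auto
  then have "0 < emeasure M {w \<in> space M. A w \<in> ?T}"
    using a \<open>(\<Sum>i\<in>I. a i *v y i) \<notin> S\<close> by (auto simp: rv_supp_def)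
  moreover have "AE w in M. \<not> A w \<in> ?T"
    using AE_good
  proof eventually_elim
    case (elim w)
    have "(\<Sum>i<N w. A w i *v (if i \<in> I then y i else 0)) \<in> S"
      using elim y zero unfolding good_def by (simp split: if_split)
    also have "(\<Sum>i<N w. A w i *v (if i \<in> I then y i else 0)) = (\<Sum>i\<in>I. A w i *v y i)"
    proof -
      have "A w i = 0" if "\<not> i < N w" for i using elim that unfolding good_def by blast
      then show ?thesis using I by (intro sum.mono_neutral_cong) auto
    qed
    finally show ?case by simp
  qed
  ultimately show False using emeasure_eq_0_AE[of "\<lambda>w. A w \<in> ?T" M] by simp
qed

text \<open>Induction on the maximal length. A prefix-free \<open>F\<close> containing the empty
  word is a singleton; otherwise it splits by first letters into prefix-free sets of shorter words,
  joined by \<open>supp_sum_in_S\<close>.\<close>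

lemma path_sum_in_S:
  assumes zero: "0 \<in> S" and fam: "\<And>u. fam u \<in> rv_supp M A" and F: "finite F"
    and prefix_free: "\<And>u x. u \<in> F \<Longrightarrow> u @ x \<in> F \<Longrightarrow> x = []" and z: "\<And>u. u \<in> F \<Longrightarrow> z u \<in> S"
  shows "(\<Sum>u\<in>F. path_prod fam u *v z u) \<in> S"
proof -
  obtain L where "\<And>u. u \<in> F \<Longrightarrow> length u \<le> L"
    using finite_imageI[OF F, of length] by (meson Max_ge imageI)
  with assms show ?thesis
  proof (induction L arbitrary: fam F z)
    case 0
    then have "u = []" if "u \<in> F" for u using that by auto
    then have "F = {} \<or> F = {[]}" by blast
    then show ?case using 0 by auto
  next
    case (Suc L)
    show ?case
    proof (cases "[] \<in> F")
      case True
      then have "F = {[]}" using Suc.prems(4)[of "[]"] by auto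
      then show ?thesis using Suc.prems by auto
    next
      case False
      define I where "I = hd ` F"
      define G where "G i = {u. i # u \<in> F}" for i
      have finI: "finite I" using Suc.prems(3) by (simp add: I_def)
      have finG: "finite (G i)" for i
        unfolding G_def using finite_vimageI[OF Suc.prems(3), of "Cons i"] by (simp add: vimage_def)
      have F_eq: "F = (\<lambda>(i, u). i # u) ` Sigma I G"
      proof -
        have "u \<in> (\<lambda>(i, u). i # u) ` Sigma I G" if "u \<in> F" for u
        proof (cases u)
          case (Cons i v)
          then show ?thesis using that
            by (intro image_eqI[of _ _ "(i, v)"]) (auto simp: I_def G_def intro!: image_eqI[of _ hd u])
        qed (use that False in auto)
        then show ?thesis by (auto simp: G_def)
      qed
      have "(\<Sum>u\<in>F. path_prod fam u *v z u) = (\<Sum>(i, u)\<in>Sigma I G. path_prod fam (i # u) *v z (i # u))"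
        unfolding F_eq by (subst sum.reindex) (auto simp: inj_on_def case_prod_beta')
      also have "\<dots> = (\<Sum>i\<in>I. \<Sum>u\<in>G i. path_prod fam (i # u) *v z (i # u))"
        using finI finG by (subst sum.Sigma) auto
      also have "\<dots> = (\<Sum>i\<in>I. fam [] i *v (\<Sum>u\<in>G i. path_prod (\<lambda>v. fam (i # v)) u *v z (i # u)))"
        by (simp add: path_prod_Cons matvec_sum_right matrix_vector_mul_assoc)
      also have "\<dots> \<in> S"
      proof (intro supp_sum_in_S zero Suc.prems(2) finI)
        fix i
        show "(\<Sum>u\<in>G i. path_prod (\<lambda>v. fam (i # v)) u *v z (i # u)) \<in> S"
        proof (rule Suc.IH[OF zero Suc.prems(2) finG])
          show "x = []" if "u \<in> G i" "u @ x \<in> G i" for u x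
            using that Suc.prems(4)[of "i # u" x] by (auto simp: G_def)
          show "z (i # u) \<in> S" if "u \<in> G i" for u using that Suc.prems(5) by (auto simp: G_def)
          show "length u \<le> L" if "u \<in> G i" for u using that Suc.prems(6)[of "i # u"] by (auto simp: G_def)
        qed
      qed
      finally show ?thesis .
    qed
  qed
qed

text \<open>Interchange the sums over \<open>j\<close> and over words: the word \<open>u\<close>
  receives the sum of the \<open>y j\<close> with \<open>u \<in> V j\<close>, a point of
  \<open>S\<close> by the assumption on subsums. Infinite \<open>V j\<close> are reached as limits
  in the closed set \<open>S\<close>.\<close>

lemma cover_sums_in_S:
  assumes zero: "0 \<in> S" and fam: "\<And>u. fam u \<in> rv_supp M A" and U: "cover_set U"
    and J: "finite J" and V: "\<And>j. j \<in> J \<Longrightarrow> V j \<subseteq> U"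
    and g: "\<And>j. j \<in> J \<Longrightarrow> (path_prod fam has_sum g j) (V j)"
    and y: "\<And>J'. J' \<subseteq> J \<Longrightarrow> (\<Sum>j\<in>J'. y j) \<in> S"
  shows "(\<Sum>j\<in>J. g j *v y j) \<in> S"
proof -
  \<comment> \<open>Extension by zero to \<open>U\<close> lets all \<open>g j\<close> be limits
    along the same filter of finite subsets.\<close>
  let ?a = "\<lambda>j u. if u \<in> V j then path_prod fam u else 0"
  have "((\<lambda>F. \<Sum>u\<in>F. ?a j u) \<longlongrightarrow> g j) (finite_subsets_at_top U)" if j: "j \<in> J" for j
  proof -
    have "(?a j has_sum g j) U"
      using V[OF j] g[OF j] by (subst has_sum_cong_neutral[where T = "V j" and g = "path_prod fam"]) auto
    then show ?thesis by (simp add: has_sum_def)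
  qed
  then have "((\<lambda>F. \<Sum>j\<in>J. (\<Sum>u\<in>F. ?a j u) *v y j) \<longlongrightarrow> (\<Sum>j\<in>J. g j *v y j)) (finite_subsets_at_top U)"
    by (intro tendsto_sum tendsto_matvec tendsto_const)
  moreover have "\<forall>\<^sub>F F in finite_subsets_at_top U. (\<Sum>j\<in>J. (\<Sum>u\<in>F. ?a j u) *v y j) \<in> S"
  proof (rule eventually_finite_subsets_at_top_weakI)
    fix F assume F: "finite F" "F \<subseteq> U"
    have "(\<Sum>j\<in>J. (\<Sum>u\<in>F. ?a j u) *v y j) = (\<Sum>u\<in>F. \<Sum>j\<in>J. ?a j u *v y j)"
      unfolding matvec_sum_left by (rule sum.swap)
    also have "\<dots> = (\<Sum>u\<in>F. path_prod fam u *v (\<Sum>j\<in>{j \<in> J. u \<in> V j}. y j))"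
    proof (intro sum.cong refl)
      fix u
      have "(\<Sum>j\<in>J. ?a j u *v y j) = (\<Sum>j\<in>{j \<in> J. u \<in> V j}. path_prod fam u *v y j)"
        using J by (intro sum.mono_neutral_cong_right) auto
      then show "(\<Sum>j\<in>J. ?a j u *v y j) = path_prod fam u *v (\<Sum>j\<in>{j \<in> J. u \<in> V j}. y j)"
        by (simp add: matvec_sum_right)
    qed
    also have "\<dots> \<in> S"
      using F cover_set_prefix_free[OF U] by (intro path_sum_in_S zero fam y) auto
    finally show "(\<Sum>j\<in>J. (\<Sum>u\<in>F. ?a j u) *v y j) \<in> S" .
  qed
  ultimately show ?thesis
    using closed_S by (intro Lim_in_closed_set) auto
qed

end

section \<open>Choice of the exponent and assembly\<close>

theorem theorem1p3:
  fixes M :: "'w measure"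
    and N :: "'w \<Rightarrow> nat"
    and A :: "'w \<Rightarrow> nat \<Rightarrow> real ^ 'd::finite ^ 'd"
    and Z :: "'w \<Rightarrow> real ^ 'd"
    and \<alpha> :: real
  defines "\<mu> \<equiv> mu_meas M N A"
  defines "EN \<equiv> (\<integral>w. real (N w) \<partial>M)"
  assumes prob: "prob_space M"
    and N_meas: "N \<in> measurable M (count_space UNIV)"
    and A_meas: "\<And>i. (\<lambda>w. A w i) \<in> borel_measurable M"
    and Z_meas: "Z \<in> borel_measurable M"
    \<comment> \<open>(C1)\<close>
    and C1_N: "AE w in M. 1 \<le> N w"
    and C1_EN_int: "integrable M (\<lambda>w. real (N w))"
    and C1_EN: "1 < EN"
    and C1_G: "AE w in M. \<forall>i. nonneg_mat (A w i)"
    and C1_nz: "AE w in M. \<forall>i. A w i \<noteq> 0 \<longleftrightarrow> i < N w"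
    \<comment> \<open>(C2)\<close>
    and C2_rows_cols: "\<forall>a\<in>gen_semigroup (meas_supp \<mu>).
          (\<forall>i. \<exists>j. 0 < a $ i $ j) \<and> (\<forall>j. \<exists>i. 0 < a $ i $ j)"
    and C2_pos: "\<exists>a\<in>gen_semigroup (meas_supp \<mu>). pos_mat a"
    \<comment> \<open>(C4) with alpha in (0,1)\<close>
    and alpha: "0 < \<alpha>" "\<alpha> < 1" "\<alpha> \<in> interior (I_mu \<mu>)"
    and C4_m: "EN * kappa \<mu> \<alpha> = 1"
    and C4_deriv: "\<exists>D. ((\<lambda>s. EN * kappa \<mu> s) has_real_derivative D) (at \<alpha>) \<and> D < 0"
    \<comment> \<open>(C6)\<close>
    and C6: "(\<integral>\<^sup>+ a. ennreal (opnorm a powr \<alpha>) *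
               (log_plus (opnorm a) + log_minus (iota (transpose a))) \<partial>\<mu>) < \<infinity>"
    \<comment> \<open>Z is an R_+^d-valued solution of the fixed-point equation\<close>
    and Z_nonneg: "AE w in M. \<forall>i. 0 \<le> Z w $ i"
    and Z_sol: "distr M borel Z =
          distr (distr M (count_space UNIV \<Otimes>\<^sub>M PiM UNIV (\<lambda>_::nat. borel)) (\<lambda>w. (N w, A w))
                 \<Otimes>\<^sub>M PiM UNIV (\<lambda>_::nat. distr M borel Z))
            borel (\<lambda>((n, a), z). \<Sum>i<n. a i *v z i)"
    and Z_nz: "measure M {w \<in> space M. Z w = 0} = 0"
  shows "\<forall>U fam. cover_set U \<and> finite_level U \<and> (\<forall>u. fam u \<in> rv_supp M A) \<longrightarrow>
           (\<forall>(k::nat) s V g. (\<forall>j<k. 0 \<le> s j \<and> V j \<subseteq> U \<and>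
                 (path_prod fam has_sum g j) (V j) \<and> pos_mat (g j)) \<longrightarrow>
              (\<Sum>j<k. s j *\<^sub>R perron_vec (g j)) \<in> rv_supp M Z)"
proof -
  interpret matrix_branching M N A
    using prob N_meas A_meas C1_EN_int C1_EN
    by (simp add: matrix_branching_def matrix_branching_axioms_def EN_def)
  have rows_cols: "(\<forall>i. \<exists>j. 0 < a $ i $ j) \<and> (\<forall>j. \<exists>i. 0 < a $ i $ j)"
    if "a \<in> meas_supp (mu_meas M N A)" for a
  proof -
    have "mat 1 ** a \<in> gen_semigroup (meas_supp \<mu>)"
      using that by (intro gen_semigroup.intros) (simp add: \<mu>_def)
    then show ?thesis using C2_rows_cols by simp
  qed
  interpret smoothing_solution M N A Z
    using Z_meas C1_N C1_G C1_nz rows_cols Z_nonneg Z_sol Z_nz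
    by unfold_locales (auto simp: nonneg_vec_def)
  obtain D where D: "((\<lambda>s. EN * kappa \<mu> s) has_real_derivative D) (at \<alpha>)" "D < 0"
    using C4_deriv by blast
  \<comment> \<open>The negative derivative yields exponents just above \<open>\<alpha>\<close> at
    which the function \<open>m\<close> of (C4) is below 1.\<close>
  obtain d where d: "0 < d" "\<And>h. 0 < h \<Longrightarrow> h < d \<Longrightarrow> EN * kappa \<mu> (\<alpha> + h) < EN * kappa \<mu> \<alpha>"
    using has_real_derivative_neg_dec_right[OF D] by auto
  obtain e where e: "0 < e" "ball \<alpha> e \<subseteq> I_mu \<mu>"
    using alpha(3) by (auto simp: mem_interior)
  \<comment> \<open>\<open>h\<close> is small enough for the decrease of \<open>m\<close>, for
    \<open>\<alpha> + h\<close> to stay in \<open>I_mu\<close>, and for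
    \<open>\<alpha> + h \<le> 1\<close>, where \<open>powr\<close> is subadditive.\<close>
  define h where "h = min (min d e) (1 - \<alpha>) / 2"
  have h: "0 < h" "h < d" "h < e" "\<alpha> + h \<le> 1"
    using d(1) e(1) alpha by (auto simp: h_def min_def field_simps)
  define s where "s = \<alpha> + h"
  have s: "0 < s" "s \<le> 1" using h alpha by (auto simp: s_def)
  have "s \<in> I_mu \<mu>" using e(2) h by (auto simp: s_def dist_real_def intro!: subsetD[OF e(2)])
  moreover have "EN * kappa \<mu> s < 1" using d(2)[OF h(1,2)] C4_m by (simp add: s_def)
  ultimately obtain n where "ennreal EN ^ n * mu.moment s n (mat 1) < 1"
    using mu.kappa_less_imp_moment_less[of s EN] C1_EN by (auto simp: \<mu>_def)
  then have small: "branching_moment s n (mat 1) < 1" by (simp add: branching_moment_def EN_def)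
  have zero: "0 \<in> S" by (rule zero_in_S[OF s small])
  \<comment> \<open>The contraction for \<open>branching_set\<close>: its norm to the power
    \<open>s\<close> is bounded by a branching moment below 1.\<close>
  obtain d0 where d0: "allowable d0" "\<And>z. z \<in> S \<Longrightarrow> d0 *v z \<in> S"
    "ennreal (opnorm d0 powr s) \<le> branching_moment s n (mat 1)"
    using descend_matrix[OF zero, of "mat 1" s n] by auto
  have "ennreal (opnorm d0 powr s) < ennreal 1" using le_less_trans[OF d0(3) small] by simp
  then have "opnorm d0 powr s < 1 powr s" by (subst (asm) ennreal_less_iff) auto
  then have d0_less: "opnorm d0 < 1"
    using powr_mono2[of s 1 "opnorm d0"] s by (force simp: not_less)
  obtain b1 b2 where b: "allowable b1" "allowable b2"
    "\<And>x y. x \<in> S \<Longrightarrow> y \<in> S \<Longrightarrow> b1 *v x + b2 *v y \<in> S"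
    using ex_branch[OF zero] by blast
  interpret B: branching_set S b1 b2 d0
    using closed_S zero nonneg_S unbounded_S[OF s small] b d0 d0_less by unfold_locales auto
  show ?thesis
  proof (intro allI impI)
    fix U fam and k :: nat and s :: "nat \<Rightarrow> real" and V g
    assume U: "cover_set U \<and> finite_level U \<and> (\<forall>u. fam u \<in> rv_supp M A)"
      and g: "\<forall>j<k. 0 \<le> s j \<and> V j \<subseteq> U \<and> (path_prod fam has_sum g j) (V j) \<and> pos_mat (g j)"
    show "(\<Sum>j<k. s j *\<^sub>R perron_vec (g j)) \<in> S"
    proof (rule B.sum_rays_in_set)
      fix y J assume y: "\<And>J. J \<subseteq> {..<k} \<Longrightarrow> (\<Sum>j\<in>J. y j) \<in> S" and J: "J \<subseteq> {..<k}"
      have "finite J" using J by (rule finite_subset) simp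
      then show "(\<Sum>j\<in>J. g j *v y j) \<in> S"
        using U g J by (intro cover_sums_in_S[OF zero, where fam = fam and U = U and V = V] y) auto
    qed (use g in auto)
  qed
qed

end
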